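(* Let $p$ be a prime, $q=p^e$, $m,k\ge1$, and let $f\in\mathbb{F}_{q^m}[x_1,\dots,x_k]$ be a homogeneous polynomial of degree $d\ge1$. Put $g=\gcd\big(d,\frac{q^m-1}{q-1}\big)$. Then \[\nu_p\big(N(f=y^q-y)\big)\ge\Big\lceil\frac{em}{g}\Big\lceil\frac{g\,k}{d}\Big\rceil\Big\rceil.\] In particular, when $g=1$, every homogeneous polynomial $f$ of degree $d$ satisfies $\nu_p(N(f=y^q-y))\ge em\lceil k/d\rceil$, and there exists a homogeneous polynomial $f$ of degree $d$ attaining equality.
   Context: $N(f=y^q-y)$ denotes the number of $(x_1,\dots,x_k,y)\in\mathbb{F}_{q^m}^{k+1}$ with $f(x_1,\dots,x_k)=y^q-y$; $\nu_p$ is the $p$-adic valuation. *)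

theory Defs
  imports Complex_Main "HOL-Library.FuncSet" "HOL-Library.Cardinality" "HOL-Computational_Algebra.Primes"
begin

text \<open>Multivariate polynomials in k variables x_0..x_(k-1) are represented by their
 coefficient functions on exponent vectors (alpha :: nat => nat, alpha i = 0 for i >= k).\<close>

definition hmonos :: "nat \<Rightarrow> nat \<Rightarrow> (nat \<Rightarrow> nat) set" where
  "hmonos k d = {\<alpha>. (\<forall>i\<ge>k. \<alpha> i = 0) \<and> (\<Sum>i<k. \<alpha> i) = d}"

definition hom_poly :: "nat \<Rightarrow> nat \<Rightarrow> ((nat \<Rightarrow> nat) \<Rightarrow> 'a::field) \<Rightarrow> bool" where
  "hom_poly k d c \<longleftrightarrow> (\<forall>\<alpha>. \<alpha> \<notin> hmonos k d \<longrightarrow> c \<alpha> = 0) \<and> (\<exists>\<alpha>\<in>hmonos k d. c \<alpha> \<noteq> 0)"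

definition peval :: "nat \<Rightarrow> nat \<Rightarrow> ((nat \<Rightarrow> nat) \<Rightarrow> 'a::field) \<Rightarrow> (nat \<Rightarrow> 'a) \<Rightarrow> 'a" where
  "peval k d c x = (\<Sum>\<alpha>\<in>hmonos k d. c \<alpha> * (\<Prod>i<k. x i ^ \<alpha> i))"

definition N_AS :: "nat \<Rightarrow> nat \<Rightarrow> nat \<Rightarrow> ((nat \<Rightarrow> nat) \<Rightarrow> 'a::{field,finite}) \<Rightarrow> nat" where
  "N_AS q k d c = card {(x, y). x \<in> {..<k} \<rightarrow>\<^sub>E (UNIV :: 'a set) \<and> peval k d c x = y ^ q - y}"

end

theory Submission
  imports Defs "HOL-Library.Poly_Mapping" "HOL-Computational_Algebra.Polynomial" "HOL-Number_Theory.Cong"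
begin

text \<open>
  Let \<open>F\<close> be the field with \<open>Q = q\<^sup>m = p\<^sup>E\<close> elements. By additive Hilbert 90, \<open>N\<close> is \<open>q\<close> times the
  number of \<open>x\<close> with \<open>tr (f x) = 0\<close>, where \<open>tr\<close> is the trace to the subfield of order \<open>q\<close>. By
  homogeneity that number does not change when \<open>f\<close> is replaced by \<open>z\<^sup>g f\<close> with \<open>z \<noteq> 0\<close>, so one may
  average over \<open>z\<close> as well.

  Gauss sums and \<open>p\<close>-adic numbers are avoided. Following Cuntz and Deninger, the monoid ring \<open>\<int>[F]\<close> of
  the multiplicative monoid of \<open>F\<close>, filtered by the powers of the kernel \<open>I\<close> of \<open>\<int>[F] \<rightarrow> F\<close>, replaces
  the Witt vectors: an integer in \<open>I\<^sup>n\<close> is divisible by \<open>p\<^sup>n\<close>. If \<open>p\<^sup>n\<close> is a power of \<open>Q\<close>, then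
  \<open>[\<Sum> u\<^sub>i]\<close> and \<open>(\<Sum> [u\<^sub>i])\<close> to the power \<open>p\<^sup>n\<close> agree modulo \<open>I\<^bsup>n+1\<^esup>\<close>. This expands the indicator of
  \<open>tr (z\<^sup>g f x) = 0\<close> into terms \<open>p\<^sup>v [t]\<close> with \<open>t\<close> a product of at most \<open>(p - 1) (v + e)\<close> monomials
  of \<open>z\<^sup>g f\<close> and their \<open>p\<close>-power conjugates, which takes the place of Stickelberger's theorem. In the
  sum over all \<open>x\<close> and \<open>z\<close> a term survives only if its exponents are divisible by \<open>Q - 1\<close>; this forces
  many factors and hence a large \<open>v\<close>.

  For \<open>g = 1\<close>, \<open>N\<close> is determined by the number of zeros of \<open>f\<close>, which is easily computed when \<open>f\<close> is a
  sum of products of disjoint sets of variables.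
\<close>

section \<open>The multiplicative monoid ring of a finite field\<close>

text \<open>The convolution product of \<open>\<Rightarrow>\<^sub>0\<close> adds keys, so the
  multiplicative monoid is wrapped in a type whose addition is multiplication.\<close>

datatype 'a mul = Mul (unmul: 'a)

instantiation mul :: (comm_monoid_mult) comm_monoid_add
begin

definition zero_mul :: "'a mul" where "zero_mul = Mul 1"

definition plus_mul :: "'a mul \<Rightarrow> 'a mul \<Rightarrow> 'a mul"
  where "plus_mul x y = Mul (unmul x * unmul y)"

instance
  by standard (simp_all add: zero_mul_def plus_mul_def mult_ac)

end

type_synonym 'a mring = "'a mul \<Rightarrow>\<^sub>0 int"

text \<open>The class [x] acts as a Teichmueller representative: multiplicative but not additive.
  The zero of a field is kept as a monoid element, so \<open>tei 0\<close> is a nonzero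
  idempotent.\<close>

definition tei :: "'a::comm_monoid_mult \<Rightarrow> 'a mring"
  where "tei x = Poly_Mapping.single (Mul x) 1"

lemma tei_1 [simp]: "tei 1 = 1"
  by (simp add: tei_def flip: zero_mul_def)

lemma tei_mult: "tei (x * y) = tei x * tei y"
  by (simp add: tei_def mult_single plus_mul_def)

lemma tei_power: "tei (x ^ n) = tei x ^ n"
  by (induction n) (simp_all add: tei_mult)

lemma tei_prod: "tei (prod f A) = (\<Prod>i\<in>A. tei (f i))"
  by (induction A rule: infinite_finite_induct) (simp_all add: tei_mult)

text \<open>The additive extension of \<tau>, a ring homomorphism whenever \<tau> respects products
  and 1; it yields both the reduction to the field and the Frobenius lift.\<close>

definition lift_mul :: "('a::{comm_monoid_mult,finite} \<Rightarrow> 'b::comm_ring_1) \<Rightarrow> 'a mring \<Rightarrow> 'b"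
  where "lift_mul \<tau> f = (\<Sum>x\<in>UNIV. of_int (Poly_Mapping.lookup f (Mul x)) * \<tau> x)"

lemma lift_mul_add: "lift_mul \<tau> (f + g) = lift_mul \<tau> f + lift_mul \<tau> g"
  by (simp add: lift_mul_def lookup_add algebra_simps sum.distrib)

lemma lift_mul_uminus: "lift_mul \<tau> (- f) = - lift_mul \<tau> f"
  by (simp add: lift_mul_def sum_negf)

lemma lift_mul_diff: "lift_mul \<tau> (f - g) = lift_mul \<tau> f - lift_mul \<tau> g"
  using lift_mul_add[of \<tau> f "- g"] by (simp add: lift_mul_uminus)

lemma lift_mul_0 [simp]: "lift_mul \<tau> 0 = 0"
  by (simp add: lift_mul_def)

lemma lift_mul_sum: "lift_mul \<tau> (sum f A) = (\<Sum>i\<in>A. lift_mul \<tau> (f i))"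
  by (induction A rule: infinite_finite_induct) (simp_all add: lift_mul_add)

lemma lift_mul_single: "lift_mul \<tau> (Poly_Mapping.single (Mul x) c) = of_int c * \<tau> x"
proof -
  have "lift_mul \<tau> (Poly_Mapping.single (Mul x) c) = (\<Sum>y\<in>UNIV. if y = x then of_int c * \<tau> y else 0)"
    unfolding lift_mul_def by (intro sum.cong) (auto simp: lookup_single when_def)
  then show ?thesis by simp
qed

lemma lift_mul_tei [simp]: "lift_mul \<tau> (tei x) = \<tau> x"
  by (simp add: tei_def lift_mul_single)

lemma mring_expand:
  fixes f :: "'a::{comm_monoid_mult,finite} mring"
  shows "f = (\<Sum>x\<in>UNIV. Poly_Mapping.single (Mul x) (Poly_Mapping.lookup f (Mul x)))"
proof (rule poly_mapping_eqI)
  fix k :: "'a mul"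
  obtain y where k: "k = Mul y" by (cases k)
  have "(\<Sum>x\<in>UNIV. Poly_Mapping.lookup (Poly_Mapping.single (Mul x) (Poly_Mapping.lookup f (Mul x))) k)
      = (\<Sum>x\<in>UNIV. if x = y then Poly_Mapping.lookup f (Mul x) else 0)"
    by (intro sum.cong) (auto simp: lookup_single when_def k)
  then show "Poly_Mapping.lookup f k = Poly_Mapping.lookup
      (\<Sum>x\<in>UNIV. Poly_Mapping.single (Mul x) (Poly_Mapping.lookup f (Mul x))) k"
    by (simp add: lookup_sum k)
qed

lemma lift_mul_mult:
  fixes f g :: "'a::{comm_monoid_mult,finite} mring"
  assumes \<tau>: "\<And>x y. \<tau> (x * y) = \<tau> x * \<tau> y"
  shows "lift_mul \<tau> (f * g) = lift_mul \<tau> f * lift_mul \<tau> g"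
proof -
  let ?f = "\<lambda>x. Poly_Mapping.lookup f (Mul x)" and ?g = "\<lambda>x. Poly_Mapping.lookup g (Mul x)"
  have "f * g = (\<Sum>x\<in>UNIV. Poly_Mapping.single (Mul x) (?f x)) * (\<Sum>x\<in>UNIV. Poly_Mapping.single (Mul x) (?g x))"
    using mring_expand[of f] mring_expand[of g] by simp
  also have "\<dots> = (\<Sum>x\<in>UNIV. \<Sum>y\<in>UNIV. Poly_Mapping.single (Mul (x * y)) (?f x * ?g y))"
    by (simp add: sum_product mult_single plus_mul_def)
  finally have "lift_mul \<tau> (f * g) = (\<Sum>x\<in>UNIV. \<Sum>y\<in>UNIV. of_int (?f x * ?g y) * \<tau> (x * y))"
    by (simp only: lift_mul_sum lift_mul_single)
  also have "\<dots> = lift_mul \<tau> f * lift_mul \<tau> g"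
    by (simp add: lift_mul_def sum_product \<tau> mult_ac)
  finally show ?thesis .
qed

lemma lift_mul_power:
  assumes "\<And>x y. \<tau> (x * y) = \<tau> x * \<tau> y" and "\<tau> 1 = 1"
  shows "lift_mul \<tau> (f ^ n) = lift_mul \<tau> f ^ n"
proof (induction n)
  case 0
  have "lift_mul \<tau> (tei 1) = 1" by (simp only: lift_mul_tei assms)
  then show ?case by simp
qed (simp add: lift_mul_mult[OF assms(1)])

lemma lift_mul_of_int:
  assumes "\<tau> 1 = 1"
  shows "lift_mul \<tau> (of_int n) = of_int n"
proof -
  have "of_int n = Poly_Mapping.single (Mul (1::'b)) n"
    by (metis of_int_eq_id id_apply single_of_int zero_mul_def)
  then show ?thesis by (simp add: lift_mul_single assms)
qed

lemma lift_mul_1: "\<tau> 1 = 1 \<Longrightarrow> lift_mul \<tau> 1 = 1"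
  using lift_mul_of_int[of \<tau> 1] by simp

lemma lift_mul_of_nat: "\<tau> 1 = 1 \<Longrightarrow> lift_mul \<tau> (of_nat n) = of_nat n"
  using lift_mul_of_int[of \<tau> "int n"] by simp

lemma lookup_of_nat_mult:
  fixes f :: "'a::comm_monoid_mult mring"
  shows "Poly_Mapping.lookup (of_nat n * f) k = int n * Poly_Mapping.lookup f k"
  by (induction n) (simp_all add: algebra_simps lookup_add)

text \<open>Coefficients are integers, so positive integers cancel. This makes the quotient of
  \<open>frob f - f ^ p\<close> by p unique.\<close>

lemma mring_torsion_free:
  fixes f g :: "'a::comm_monoid_mult mring"
  assumes "of_nat n * f = of_nat n * g" and "n > 0"
  shows "f = g"
proof (rule poly_mapping_eqI)
  fix k
  have "int n * Poly_Mapping.lookup f k = int n * Poly_Mapping.lookup g k"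
    using assms(1) by (metis lookup_of_nat_mult)
  then show "Poly_Mapping.lookup f k = Poly_Mapping.lookup g k" using assms(2) by simp
qed

section \<open>Reduction to the field and the powers of its kernel\<close>

definition residue :: "'a::{field,finite} mring \<Rightarrow> 'a"
  where "residue = lift_mul (\<lambda>x. x)"

lemma residue_tei [simp]: "residue (tei x) = x"
  and residue_0 [simp]: "residue 0 = 0"
  and residue_1 [simp]: "residue 1 = 1"
  and residue_add: "residue (f + g) = residue f + residue g"
  and residue_diff: "residue (f - g) = residue f - residue g"
  and residue_uminus: "residue (- f) = - residue f"
  and residue_mult: "residue (f * g) = residue f * residue g"
  and residue_power: "residue (f ^ n) = residue f ^ n"
  and residue_sum: "residue (sum h A) = (\<Sum>i\<in>A. residue (h i))"
  and residue_of_int [simp]: "residue (of_int a) = of_int a"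
  and residue_of_nat [simp]: "residue (of_nat n) = of_nat n"
  by (simp_all add: residue_def lift_mul_add lift_mul_diff lift_mul_uminus lift_mul_mult lift_mul_power
      lift_mul_sum lift_mul_of_int lift_mul_1 lift_mul_of_nat)

text \<open>\<open>ipow n\<close> is the \<open>n\<close>-th power of the kernel of \<^const>\<open>residue\<close>.\<close>

inductive ipow :: "nat \<Rightarrow> 'a::{field,finite} mring \<Rightarrow> bool" where
  ipow_0 [simp, intro]: "ipow 0 f"
| ipow_zero [simp, intro]: "ipow n 0"
| ipow_add: "ipow n f \<Longrightarrow> ipow n g \<Longrightarrow> ipow n (f + g)"
| ipow_step: "residue f = 0 \<Longrightarrow> ipow n g \<Longrightarrow> ipow (Suc n) (f * g)"

lemma ipow_mult: "ipow n f \<Longrightarrow> ipow n (a * f)"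
proof (induction rule: ipow.induct)
  case (ipow_step f n g)
  then show ?case using ipow.ipow_step[of "a * f" n g]
    by (simp add: residue_mult mult.assoc)
qed (auto simp: distrib_left intro: ipow_add)

lemma ipow_mult2: "ipow n f \<Longrightarrow> ipow n (f * a)"
  using ipow_mult[of n f a] by (simp add: mult.commute)

lemma ipow_uminus: "ipow n f \<Longrightarrow> ipow n (- f)"
  using ipow_mult[of n f "-1"] by simp

lemma ipow_diff: "ipow n f \<Longrightarrow> ipow n g \<Longrightarrow> ipow n (f - g)"
  using ipow_add[of n f "- g"] ipow_uminus[of n g] by simp

lemma ipow_sum: "(\<And>i. i \<in> A \<Longrightarrow> ipow n (f i)) \<Longrightarrow> ipow n (sum f A)"
  by (induction A rule: infinite_finite_induct) (auto intro: ipow_add)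

lemma ipow_SucD: "ipow (Suc n) f \<Longrightarrow> ipow n f"
proof (induction "Suc n" f arbitrary: n rule: ipow.induct)
  case (ipow_step f n g)
  then show ?case by (auto intro: ipow_mult)
qed (auto intro: ipow_add)

lemma ipow_mono: "ipow n f \<Longrightarrow> m \<le> n \<Longrightarrow> ipow m f"
proof (induction n)
  case (Suc n)
  then show ?case using ipow_SucD le_Suc_eq by blast
qed simp

lemma ipow_mult_add: "ipow n f \<Longrightarrow> ipow m g \<Longrightarrow> ipow (n + m) (f * g)"
proof (induction arbitrary: rule: ipow.induct)
  case (ipow_0 f)
  then show ?case by (simp add: ipow_mult)
next
  case (ipow_step f n h)
  then show ?case using ipow.ipow_step[of f "n + m" "h * g"] by (simp add: mult.assoc)
qed (auto simp: distrib_right intro: ipow_add)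

lemma ipow_1_iff: "ipow (Suc 0) f \<longleftrightarrow> residue f = 0"
proof
  show "ipow (Suc 0) f \<Longrightarrow> residue f = 0"
    by (induction "Suc 0" f rule: ipow.induct) (auto simp: residue_add residue_mult)
qed (use ipow_step[of f 0 1] in auto)

lemma ipow_prod:
  assumes "finite A" and "\<And>i. i \<in> A \<Longrightarrow> ipow (n i) (f i)"
  shows "ipow (sum n A) (prod f A)"
  using assms by (induction A rule: finite_induct) (auto intro: ipow_mult_add)

lemma ipow_power: "ipow n f \<Longrightarrow> ipow (n * j) (f ^ j)"
  by (induction j) (auto intro: ipow_mult_add)

lemma ipow_power_diff:
  assumes "ipow n (f - f')"
  shows "ipow n (f ^ j - f' ^ j)"
proof (induction j)
  case (Suc j)
  have "f ^ Suc j - f' ^ Suc j = f * (f ^ j - f' ^ j) + (f - f') * f' ^ j"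
    by (simp add: algebra_simps)
  then show ?case using Suc assms by (auto intro: ipow_add ipow_mult ipow_mult2)
qed simp

text \<open>An idempotent in the kernel lies in all powers of the kernel.\<close>

lemma ipow_tei_0: "ipow n (tei 0)"
proof (induction n)
  case (Suc n)
  have "tei 0 = tei 0 * tei (0::'a)" by (simp flip: tei_mult)
  then show ?case using ipow_step[of "tei (0::'a)" n "tei 0"] Suc by simp
qed simp

section \<open>Finite field arithmetic, and p-th powers modulo kernel powers\<close>

locale finite_field_card =
  fixes p E :: nat and ty :: "'a::{field,finite} itself"
  assumes prime_p: "prime p" and card_p: "CARD('a) = p ^ E"
begin

abbreviation "Q \<equiv> p ^ E"

lemma p_ge_2: "p \<ge> 2" using prime_p prime_ge_2_nat by blast

lemma p_pos [simp]: "p > 0" "p \<noteq> 0" "Suc 0 \<le> p" using p_ge_2 by simp_all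

lemma E_pos: "E > 0"
proof (rule ccontr)
  assume "\<not> E > 0"
  then have "CARD('a) = 1" using card_p by simp
  then have "(0::'a) = 1" by (metis UNIV_I card_1_singletonE singletonD)
  then show False by simp
qed

lemma Q_gt_1: "Q > 1" using p_ge_2 E_pos by (intro one_less_power) auto

lemma CHAR_eq: "CHAR('a) = p"
proof -
  have "prime CHAR('a)" by (simp add: prime_CHAR_semidom finite_imp_CHAR_pos)
  moreover have "CHAR('a) dvd CARD('a)"
  proof -
    \<comment> \<open>Translation by 1 permutes the field; comparing the two sums shows that the
      number of elements vanishes in it.\<close>
    have "(\<Sum>x\<in>UNIV. x + 1 :: 'a) = (\<Sum>x\<in>UNIV. x)"
      by (rule sum.reindex_bij_witness[of _ "\<lambda>x. x - 1" "\<lambda>x. x + 1"]) auto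
    then show ?thesis by (simp add: sum.distrib of_nat_eq_0_iff_char_dvd)
  qed
  ultimately show ?thesis using prime_p card_p
    by (metis prime_dvd_power primes_dvd_imp_eq)
qed

lemma of_nat_p [simp]: "of_nat p = (0::'a)"
  by (metis CHAR_eq of_nat_CHAR)

lemma add_power_p: "(x + y) ^ p = x ^ p + (y::'a) ^ p"
  by (rule freshmans_dream) (simp_all only: CHAR_eq prime_p)

lemma sum_power_p: "(sum f A :: 'a) ^ p = (\<Sum>i\<in>A. f i ^ p)"
  by (induction A rule: infinite_finite_induct) (use p_ge_2 in \<open>auto simp: add_power_p\<close>)

lemma sum_power_p_power: "(sum f A :: 'a) ^ (p ^ n) = (\<Sum>i\<in>A. f i ^ (p ^ n))"
  by (induction n) (simp_all add: power_mult sum_power_p power_Suc2 del: power_Suc)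

lemma power_Q1:
  assumes "x \<noteq> (0::'a)"
  shows "x ^ (Q - 1) = 1"
proof -
  have "(\<Prod>y\<in>UNIV - {0}. x * y) = \<Prod>(UNIV - {0})"
    by (rule prod.reindex_bij_witness[of _ "\<lambda>y. y / x" "\<lambda>y. x * y"]) (use assms in auto)
  then have "x ^ (Q - 1) * \<Prod>(UNIV - {0}) = \<Prod>(UNIV - {0})"
    by (simp add: prod.distrib card_Diff_singleton card_p)
  moreover have "\<Prod>(UNIV - {0::'a}) \<noteq> 0" by simp
  ultimately show ?thesis by simp
qed

lemma power_Q [simp]: "x ^ Q = (x::'a)"
proof (cases "x = 0")
  case False
  have "x ^ Suc (Q - 1) = x * x ^ (Q - 1)" by (rule power_Suc)
  moreover have "Suc (Q - 1) = Q" using Q_gt_1 by simp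
  ultimately show ?thesis by (simp only: power_Q1[OF False]) simp
qed (use Q_gt_1 in simp)

lemma power_cong:
  assumes "x \<noteq> (0::'a)" and "[a = b] (mod (Q - 1))"
  shows "x ^ a = x ^ b"
proof -
  have *: "x ^ a = x ^ (a mod (Q - 1))" for a
  proof -
    have "x ^ a = x ^ ((Q - 1) * (a div (Q - 1)) + a mod (Q - 1))" by simp
    then show ?thesis by (simp only: power_add power_mult power_Q1[OF assms(1)]) simp
  qed
  show ?thesis using *[of a] *[of b] assms(2) by (simp add: cong_def)
qed

lemma ipow_of_nat_p: "ipow (Suc 0) (of_nat p :: 'a mring)"
  by (simp add: ipow_1_iff)

lemma ipow_p_power: "ipow n (of_nat (p ^ n) :: 'a mring)"
  using ipow_power[OF ipow_of_nat_p, of n] by simp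

text \<open>Primality makes the middle coefficients divisible by p. Their quotients are written out
  so that the factor p can be cancelled or traded for a gain in a filtration.\<close>

lemma binomial_p:
  fixes f g :: "'r::comm_ring_1"
  shows "(f + g) ^ p = f ^ p + g ^ p
    + of_nat p * (\<Sum>i\<in>{0<..<p}. of_nat ((p choose i) div p) * f ^ i * g ^ (p - i))"
proof -
  have "{..p} = insert 0 (insert p {0<..<p})" using p_ge_2 by auto
  then have "(f + g) ^ p = f ^ p + g ^ p + (\<Sum>i\<in>{0<..<p}. of_nat (p choose i) * f ^ i * g ^ (p - i))"
    using p_ge_2 by (simp add: binomial_ring add_ac)
  also have "(\<Sum>i\<in>{0<..<p}. of_nat (p choose i) * f ^ i * g ^ (p - i))
    = (\<Sum>i\<in>{0<..<p}. of_nat p * (of_nat ((p choose i) div p) * f ^ i * g ^ (p - i)))"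
  proof (intro sum.cong refl)
    fix i assume "i \<in> {0<..<p}"
    then have "p dvd (p choose i)" using prime_p by (intro dvd_choose_prime) auto
    then have "(of_nat (p choose i) :: 'r) = of_nat p * of_nat ((p choose i) div p)"
      by (metis dvd_mult_div_cancel of_nat_mult)
    then show "of_nat (p choose i) * f ^ i * g ^ (p - i)
        = of_nat p * (of_nat ((p choose i) div p) * f ^ i * g ^ (p - i))"
      by (simp add: mult.assoc)
  qed
  finally show ?thesis by (simp add: sum_distrib_left)
qed

text \<open>With h = f - g, the term \<open>h ^ p\<close> vanishes to order (n + 1) p \<ge> n + 2,
  and the mixed terms gain one order from the factor p, which itself lies in the kernel.\<close>

lemma ipow_power_p_cong:
  assumes "ipow (Suc n) (f - g :: 'a mring)"
  shows "ipow (Suc (Suc n)) (f ^ p - g ^ p)"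
proof -
  define h where "h = f - g"
  have h: "ipow (Suc n) h" using assms by (simp add: h_def)
  have f: "f = h + g" by (simp add: h_def)
  have "f ^ p - g ^ p = h ^ p
      + of_nat p * (\<Sum>i\<in>{0<..<p}. of_nat ((p choose i) div p) * h ^ i * g ^ (p - i))"
    unfolding f by (simp add: binomial_p)
  moreover have "ipow (Suc (Suc n)) (h ^ p)"
  proof (rule ipow_mono[OF ipow_power[OF h]])
    have "Suc n * 2 \<le> Suc n * p" using p_ge_2 by (intro mult_le_mono2)
    then show "Suc (Suc n) \<le> Suc n * p" by simp
  qed
  moreover have "ipow (Suc n) (\<Sum>i\<in>{0<..<p}. of_nat ((p choose i) div p) * h ^ i * g ^ (p - i))"
  proof (rule ipow_sum)
    fix i assume "i \<in> {0<..<p}"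
    then have "Suc n * 1 \<le> Suc n * i" by (intro mult_le_mono) auto
    then have "Suc n \<le> Suc n * i" by simp
    then have "ipow (Suc n) (h ^ i)" using ipow_mono[OF ipow_power[OF h]] by blast
    then show "ipow (Suc n) (of_nat ((p choose i) div p) * h ^ i * g ^ (p - i))"
      by (intro ipow_mult2[OF ipow_mult])
  qed
  ultimately show ?thesis
    using ipow_mult_add[OF ipow_of_nat_p] by (auto intro: ipow_add)
qed

text \<open>The difference starts in the kernel and each p-th power gains one order. This allows the
  class of a sum to be replaced by the sum of the classes.\<close>

lemma ipow_power_p_power_cong:
  assumes "residue f = residue (g :: 'a mring)"
  shows "ipow (Suc n) (f ^ (p ^ n) - g ^ (p ^ n))"
proof (induction n)
  case 0
  show ?case using assms by (simp add: ipow_1_iff residue_diff)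
next
  case (Suc n)
  then show ?case using ipow_power_p_cong[OF Suc] by (simp add: power_Suc2 power_mult del: power_Suc)
qed

section \<open>The Frobenius lift, and integers in kernel powers\<close>

definition frob :: "'a mring \<Rightarrow> 'a mring" where
  "frob = lift_mul (\<lambda>x. tei (x ^ p))"

lemma frob_add: "frob (f + g) = frob f + frob g"
  and frob_mult: "frob (f * g) = frob f * frob g"
  and frob_tei [simp]: "frob (tei x) = tei (x ^ p)"
  and frob_0 [simp]: "frob 0 = 0"
  and frob_uminus [simp]: "frob (- f) = - frob f"
  and frob_of_int [simp]: "frob (of_int a) = of_int a"
  by (simp_all add: frob_def lift_mul_add lift_mul_uminus lift_mul_mult lift_mul_of_int power_mult_distrib tei_mult)

lemma mring_induct [case_names tei zero add uminus]:
  fixes f :: "'a mring"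
  assumes tei: "\<And>x. P (tei x)" and zero: "P 0" and add: "\<And>f g. P f \<Longrightarrow> P g \<Longrightarrow> P (f + g)"
    and uminus: "\<And>f. P f \<Longrightarrow> P (- f)"
  shows "P f"
proof -
  have nat: "P (Poly_Mapping.single (Mul x) (int n))" for x n
  proof (induction n)
    case (Suc n)
    then show ?case using add[OF tei[of x] Suc]
      by (simp add: tei_def flip: single_add)
  qed (simp add: zero)
  have "P (Poly_Mapping.single (Mul x) c)" for x c
  proof (cases "c \<ge> 0")
    case True
    then show ?thesis using nat[of x "nat c"] by simp
  next
    case False
    then show ?thesis using uminus[OF nat[of x "nat (- c)"]] by (simp flip: single_uminus)
  qed
  then have "P (\<Sum>x\<in>A. Poly_Mapping.single (Mul x) (Poly_Mapping.lookup f (Mul x)))" for A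
    by (induction A rule: infinite_finite_induct) (auto intro: zero add)
  then show ?thesis by (subst mring_expand)
qed

lemma residue_frob: "residue (frob f) = residue f ^ p"
proof (induction f rule: mring_induct)
  case (uminus f)
  have "residue (- f) ^ p + residue f ^ p = (residue (- f) + residue f) ^ p"
    by (simp only: add_power_p)
  then show ?case using uminus by (simp add: residue_uminus zero_power add_eq_0_iff2)
qed (use p_ge_2 in \<open>auto simp: frob_add residue_add add_power_p\<close>)

lemma frob_ipow: "ipow n f \<Longrightarrow> ipow n (frob f)"
proof (induction rule: ipow.induct)
  case (ipow_step f n g)
  then show ?case using p_ge_2 by (auto simp: frob_mult residue_frob intro!: ipow.ipow_step)
qed (auto simp: frob_add intro: ipow_add)

text \<open>The addition law of the p-derivation (frob f - f^p)/p: its failure to be additive is the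
  usual carry polynomial.\<close>

lemma frob_cong_add:
  assumes "frob f - f ^ p = of_nat p * a" and "frob g - g ^ p = of_nat p * b"
  shows "frob (f + g) - (f + g) ^ p = of_nat p *
    (a + b - (\<Sum>i\<in>{0<..<p}. of_nat ((p choose i) div p) * f ^ i * g ^ (p - i)))"
  using assms by (simp add: frob_add binomial_p algebra_simps)

lemma frob_cong: "\<exists>a. frob f - f ^ p = of_nat p * a"
proof (induction f rule: mring_induct)
  case (tei x)
  show ?case by (intro exI[of _ 0]) (simp add: tei_power)
next
  case zero
  then show ?case by (intro exI[of _ 0]) (simp add: zero_power)
next
  case (add f g)
  then show ?case using frob_cong_add by blast
next
  case (uminus f)
  then obtain a where a: "frob f - f ^ p = of_nat p * a" by blast
  show ?case
  proof (cases "p = 2")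
    case True
    \<comment> \<open>Squaring loses the sign; the discrepancy, twice the square of f, is absorbed
      in the quotient.\<close>
    have "frob (- f) - (- f) ^ p = of_nat p * (- a - f ^ p)"
    proof -
      have "(- f) ^ p = f ^ p" and "of_nat p * f ^ p = f ^ p + f ^ p"
        using True by simp_all
      then show ?thesis using a by (simp add: right_diff_distrib) (simp flip: a)
    qed
    then show ?thesis by blast
  next
    case False
    then have "odd p" using prime_p primes_dvd_imp_eq two_is_prime_nat by blast
    then have "frob (- f) - (- f) ^ p = of_nat p * (- a)"
      using a by (simp flip: a)
    then show ?thesis by blast
  qed
qed

text \<open>Since \<open>frob f - f ^ p\<close> divided by \<open>p\<close> is a \<open>p\<close>-derivation, it lowers the
  order of vanishing along the kernel of \<^const>\<open>residue\<close> by at most one.\<close>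

lemma frob_cong_ipow:
  "ipow n f \<Longrightarrow> \<exists>a. frob f - f ^ p = of_nat p * a \<and> ipow (n - 1) a"
proof (induction rule: ipow.induct)
  case (ipow_0 f)
  then show ?case using frob_cong by auto
next
  case (ipow_zero n)
  then show ?case by (intro exI[of _ 0]) (simp add: zero_power)
next
  case (ipow_add n f g)
  then obtain a b where ab: "frob f - f ^ p = of_nat p * a" "ipow (n - 1) a"
      "frob g - g ^ p = of_nat p * b" "ipow (n - 1) b" by blast
  have "ipow n (\<Sum>i\<in>{0<..<p}. of_nat ((p choose i) div p) * f ^ i * g ^ (p - i))"
  proof (rule ipow_sum)
    fix i assume "i \<in> {0<..<p}"
    then have "n \<le> n * i" by simp
    then have "ipow n (f ^ i)" using ipow_mono[OF ipow_power[OF ipow_add(1)]] by blast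
    then show "ipow n (of_nat ((p choose i) div p) * f ^ i * g ^ (p - i))"
      by (intro ipow_mult2[OF ipow_mult])
  qed
  then have "ipow (n - 1) (\<Sum>i\<in>{0<..<p}. of_nat ((p choose i) div p) * f ^ i * g ^ (p - i))"
    by (rule ipow_mono) simp
  then show ?case using frob_cong_add[OF ab(1,3)] ab(2,4)
    by (meson ipow_diff ipow.ipow_add)
next
  case (ipow_step f n g)
  obtain a where a: "frob f - f ^ p = of_nat p * a" using frob_cong by blast
  obtain b where b: "frob g - g ^ p = of_nat p * b" "ipow (n - 1) b"
    using ipow_step by blast
  \<comment> \<open>Product rule of the p-derivation. The first summand keeps the order n of g; in
    the second, g loses one order, which \<open>f ^ p\<close> restores.\<close>
  have "frob (f * g) - (f * g) ^ p = (frob f - f ^ p) * frob g + f ^ p * (frob g - g ^ p)"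
    by (simp add: frob_mult power_mult_distrib algebra_simps)
  also have "\<dots> = of_nat p * (a * frob g + f ^ p * b)" by (simp add: a b algebra_simps)
  finally have "frob (f * g) - (f * g) ^ p = of_nat p * (a * frob g + f ^ p * b)" .
  moreover have "ipow n (f ^ p * b)"
  proof (cases n)
    case (Suc m)
    have "residue (f ^ p) = 0" using ipow_step(1) p_ge_2 by (simp add: residue_power)
    then show ?thesis using ipow.ipow_step[of "f ^ p" m b] b(2) Suc by simp
  qed simp
  moreover have "ipow n (a * frob g)" using ipow_step frob_ipow ipow_mult by blast
  ultimately show ?case by (auto intro: ipow_add)
qed

text \<open>The Frobenius lift fixes N, so N - N^p = p a with a one order lower. Writing N = p M
  gives a = M (1 - N^(p-1)), whose second factor is prime to p, and induction applies to a.\<close>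

lemma ipow_of_int_dvd: "ipow n (of_int N :: 'a mring) \<Longrightarrow> int p ^ n dvd N"
proof (induction n arbitrary: N)
  case (Suc n)
  have "residue (of_int N :: 'a mring) = 0"
    using ipow_mono[OF Suc.prems, of "Suc 0"] by (simp add: ipow_1_iff)
  then have "int p dvd N" using of_int_eq_0_iff_char_dvd[of N, where ?'a = 'a] by (simp add: CHAR_eq)
  then obtain M where M: "N = int p * M" by blast
  obtain a where a: "of_int N - of_int N ^ p = of_nat p * a" "ipow n (a :: 'a mring)"
    using frob_cong_ipow[OF Suc.prems] by auto
  have "N - N ^ p = int p * (M * (1 - N ^ (p - 1)))"
    using p_ge_2 by (cases p) (auto simp: M algebra_simps)
  then have "of_int N - of_int N ^ p = of_nat p * (of_int (M * (1 - N ^ (p - 1))) :: 'a mring)"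
    by (metis of_int_diff of_int_mult of_int_of_nat_eq of_int_power)
  then have "a = of_int (M * (1 - N ^ (p - 1)))"
    using a(1) mring_torsion_free p_ge_2 by (metis zero_less_iff_neq_zero not_numeral_le_zero)
  then have "int p ^ n dvd M * (1 - N ^ (p - 1))" using a(2) Suc.IH by simp
  moreover have "coprime (int p ^ n) (1 - N ^ (p - 1))"
  proof -
    have "int p dvd N ^ (p - 1)" using \<open>int p dvd N\<close> p_ge_2 by (simp add: dvd_power_iff_le dvd_trans[OF _ dvd_power])
    then have "\<not> int p dvd 1 - N ^ (p - 1)"
      using p_ge_2 by (metis diff_add_cancel dvd_add zdvd1_eq abs_of_nat of_nat_1 of_nat_eq_iff numeral_le_one_iff semiring_norm(69))
    then show ?thesis using prime_p by (simp add: prime_imp_coprime)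
  qed
  ultimately have "int p ^ n dvd M" by (simp add: coprime_dvd_mult_left_iff)
  then show ?case by (simp add: M)
qed simp

section \<open>Filtration by divisibility and number of monomial factors\<close>

text \<open>Otherwise all Q - 1 nonzero elements would be roots of X^b' - 1, where b' is the
  remainder of b and 0 < b' < Q - 1.\<close>

lemma ex_power_neq_1:
  assumes "\<not> (Q - 1) dvd b"
  shows "\<exists>c::'a. c \<noteq> 0 \<and> c ^ b \<noteq> 1"
proof (rule ccontr)
  define b' where "b' = b mod (Q - 1)"
  have b': "b' > 0" "b' < Q - 1"
    using assms Q_gt_1 by (auto simp: b'_def mod_greater_zero_iff_not_dvd)
  assume "\<nexists>c::'a. c \<noteq> 0 \<and> c ^ b \<noteq> 1"
  moreover have "c ^ b' = c ^ b" if "c \<noteq> 0" for c :: 'a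
    using that by (intro power_cong) (simp_all add: b'_def)
  ultimately have "UNIV - {0::'a} \<subseteq> {x. poly (monom 1 b' - 1) x = 0}"
    by (auto simp: poly_monom)
  then have "card (UNIV - {0::'a}) \<le> card {x::'a. poly (monom 1 b' - 1) x = 0}"
    by (intro card_mono) auto
  also have "\<dots> \<le> degree (monom (1::'a) b' - 1)"
  proof (rule card_poly_roots_bound)
    have "coeff (monom (1::'a) b' - 1) b' = 1" using b' by simp
    then show "monom (1::'a) b' - 1 \<noteq> 0" by (metis coeff_0 zero_neq_one)
  qed
  also have "\<dots> \<le> b'" by (intro degree_diff_le) (auto simp: degree_monom_le)
  finally show False using b' by (simp add: card_Diff_singleton card_p)
qed

text \<open>Substituting c x for x shows that 1 - [c^b] annihilates the sum S. With \<mu> inverse to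
  1 - c^b, the element 1 - [\<mu>] (1 - [c^b]) lies in the kernel and fixes S, so S lies in every
  power of the kernel.\<close>

lemma ipow_sum_tei_power:
  assumes "\<not> (Q - 1) dvd b" and A: "A = UNIV \<or> A = UNIV - {0::'a}"
  shows "ipow n (\<Sum>x\<in>A. tei x ^ b)"
proof -
  obtain c :: 'a where c: "c \<noteq> 0" "c ^ b \<noteq> 1" using ex_power_neq_1[OF assms(1)] by blast
  define S where "S = (\<Sum>x\<in>A. tei x ^ b)"
  have "(\<Sum>x\<in>A. tei (c * x) ^ b) = S" unfolding S_def
    by (rule sum.reindex_bij_witness[of _ "\<lambda>y. y / c" "\<lambda>y. c * y"]) (use A c(1) in auto)
  then have S: "tei (c ^ b) * S = S"
    by (simp add: S_def tei_mult tei_power power_mult_distrib sum_distrib_left)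
  define \<mu> where "\<mu> = 1 / (1 - c ^ b)"
  have "(1 - tei \<mu> * (1 - tei (c ^ b))) * S = S - tei \<mu> * S + tei \<mu> * (tei (c ^ b) * S)"
    by (simp add: algebra_simps)
  then have "S = (1 - tei \<mu> * (1 - tei (c ^ b))) * S" by (simp add: S)
  moreover have "residue (1 - tei \<mu> * (1 - tei (c ^ b))) = 0"
    using c(2) by (simp add: residue_diff residue_mult \<mu>_def)
  ultimately have "ipow (Suc n) S" if "ipow n S" for n
    using ipow_step that by metis
  then have "ipow n S" by (induction n) auto
  then show ?thesis by (simp add: S_def)
qed

lemma p_power_mod_cong: "[p ^ (l mod E) = p ^ l] (mod (Q - 1))"
proof -
  have "[Q = 1] (mod (Q - 1))" using Q_gt_1 by (simp add: cong_def le_mod_geq)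
  then have "[Q ^ (l div E) * p ^ (l mod E) = 1 ^ (l div E) * p ^ (l mod E)] (mod (Q - 1))"
    by (intro cong_mult cong_pow) auto
  moreover have "Q ^ (l div E) * p ^ (l mod E) = p ^ l" by (simp flip: power_mult power_add)
  ultimately show ?thesis by (simp add: cong_sym)
qed

text \<open>At x = 0 the congruence does not suffice since 0^0 = 1. This is why \<open>mon\<close>
  records which exponents are zero.\<close>

lemma power_cong0:
  assumes "[a = b] (mod (Q - 1))" and "a = 0 \<longleftrightarrow> b = 0"
  shows "x ^ a = (x::'a) ^ b"
  using assms power_cong[of x a b] by (cases "x = 0") (auto simp: power_0_left)

lemma Q_eq: "Q - 1 = (p - 1) * (\<Sum>l<E. p ^ l)"
  using power_diff_1_eq[of "int p" E] p_ge_2 Q_gt_1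
  by (simp flip: of_nat_eq_iff[where 'a = int] add: of_nat_diff)

end

section \<open>Products of monomials and the filtration they define\<close>

locale weighted_monomials = finite_field_card +
  fixes k d g :: nat
  assumes d_pos: "d > 0" and g_dvd: "g dvd p ^ E - 1"
begin

lemma g_pos: "g > 0"
  using g_dvd Q_gt_1 by (intro Nat.gr0I) auto

text \<open>A product \<open>t\<close> of \<open>n\<close> monomials of the form \<open>c z\<^sup>g x\<^sup>\<alpha>\<close>, each raised to
  some power \<open>p\<^sup>i\<close>. Here \<open>A l\<close> and \<open>b l\<close> are the exponents of the \<open>p\<^sup>l\<close>-th power of \<open>t\<close>
  after reducing the powers \<open>p\<^bsup>i+l\<^esup>\<close> of the factors modulo \<open>Q - 1\<close>. Stickelberger's digit sum
  is replaced by the count \<open>n\<close>.\<close>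

definition mon :: "nat \<Rightarrow> ((nat \<Rightarrow> 'a) \<Rightarrow> 'a \<Rightarrow> 'a) \<Rightarrow> bool" where
  "mon n t \<longleftrightarrow> (\<exists>C A b.
     (\<forall>x z. z \<noteq> 0 \<longrightarrow> t x z = C * z ^ (g * A 0) * (\<Prod>i<k. x i ^ b 0 i)) \<and>
     (\<forall>l. (\<Sum>i<k. b l i) = d * A l) \<and>
     (\<Sum>l<E. A l) = n * (\<Sum>l<E. p ^ l) \<and>
     (\<forall>l. A (l + E) = A l) \<and>
     (\<forall>l. [A (Suc l) = p * A l] (mod (Q - 1))) \<and>
     (\<forall>l i. [b (Suc l) i = p * b l i] (mod (Q - 1))) \<and>
     (\<forall>l i. b (Suc l) i = 0 \<longleftrightarrow> b l i = 0))"

lemma mon_base: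
  assumes "(\<Sum>i<k. \<alpha> i) = d"
  shows "mon (Suc 0) (\<lambda>x z. C * z ^ g * (\<Prod>i<k. x i ^ \<alpha> i))"
proof -
  have *: "[p ^ (Suc l mod E) = p * p ^ (l mod E)] (mod (Q - 1))" for l
    using p_power_mod_cong[of "Suc l"] cong_scalar_left[OF p_power_mod_cong[of l], of p]
    by (auto intro: cong_trans cong_sym)
  have **: "[p ^ (Suc l mod E) * \<alpha> i = p * (p ^ (l mod E) * \<alpha> i)] (mod (Q - 1))" for l i
    using cong_scalar_right[OF *, of l "\<alpha> i"] by (simp only: mult.assoc)
  \<comment> \<open>Only the power of p is reduced, by taking l modulo E. Reducing each exponent by
    itself would destroy the exact relation between the degree in x and \<open>A l\<close>.\<close>
  show ?thesis unfolding mon_def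
    by (rule exI[of _ C], rule exI[of _ "\<lambda>l. p ^ (l mod E)"], rule exI[of _ "\<lambda>l i. p ^ (l mod E) * \<alpha> i"])
      (use assms * ** p_pos in \<open>auto simp: E_pos simp flip: sum_distrib_left simp del: One_nat_def\<close>)
qed

lemma mon_1: "mon 0 (\<lambda>x z. 1)"
  unfolding mon_def
  by (rule exI[of _ 1], rule exI[of _ "\<lambda>l. 0"], rule exI[of _ "\<lambda>l i. 0"]) auto

lemma mon_mult:
  assumes "mon n s" and "mon n' t"
  shows "mon (n + n') (\<lambda>x z. s x z * t x z)"
proof -
  obtain C A b where s:
     "\<And>x z. z \<noteq> 0 \<Longrightarrow> s x z = C * z ^ (g * A 0) * (\<Prod>i<k. x i ^ b 0 i)"
     "\<And>l. (\<Sum>i<k. b l i) = d * A l"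
     "(\<Sum>l<E. A l) = n * (\<Sum>l<E. p ^ l)"
     "\<And>l. A (l + E) = A l"
     "\<And>l. [A (Suc l) = p * A l] (mod (Q - 1))"
     "\<And>l i. [b (Suc l) i = p * b l i] (mod (Q - 1))"
     "\<And>l i. b (Suc l) i = 0 \<longleftrightarrow> b l i = 0"
    using assms(1) unfolding mon_def by blast
  obtain C' A' b' where t:
     "\<And>x z. z \<noteq> 0 \<Longrightarrow> t x z = C' * z ^ (g * A' 0) * (\<Prod>i<k. x i ^ b' 0 i)"
     "\<And>l. (\<Sum>i<k. b' l i) = d * A' l"
     "(\<Sum>l<E. A' l) = n' * (\<Sum>l<E. p ^ l)"
     "\<And>l. A' (l + E) = A' l"
     "\<And>l. [A' (Suc l) = p * A' l] (mod (Q - 1))"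
     "\<And>l i. [b' (Suc l) i = p * b' l i] (mod (Q - 1))"
     "\<And>l i. b' (Suc l) i = 0 \<longleftrightarrow> b' l i = 0"
    using assms(2) unfolding mon_def by blast
  show ?thesis unfolding mon_def
    by (rule exI[of _ "C * C'"], rule exI[of _ "\<lambda>l. A l + A' l"], rule exI[of _ "\<lambda>l i. b l i + b' l i"])
      (simp add: s t sum.distrib distrib_left distrib_right power_add prod.distrib cong_add mult_ac
        del: One_nat_def)
qed

text \<open>The p-th power is described by the shifted sequences, and periodicity keeps the sum over
  one period. So the count n does not grow under p-th powers.\<close>

lemma mon_power_p:
  assumes "mon n t"
  shows "mon n (\<lambda>x z. t x z ^ p)"
proof -
  obtain C A b where t:
     "\<And>x z. z \<noteq> 0 \<Longrightarrow> t x z = C * z ^ (g * A 0) * (\<Prod>i<k. x i ^ b 0 i)"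
     "\<And>l. (\<Sum>i<k. b l i) = d * A l"
     "(\<Sum>l<E. A l) = n * (\<Sum>l<E. p ^ l)"
     "\<And>l. A (l + E) = A l"
     "\<And>l. [A (Suc l) = p * A l] (mod (Q - 1))"
     "\<And>l i. [b (Suc l) i = p * b l i] (mod (Q - 1))"
     "\<And>l i. b (Suc l) i = 0 \<longleftrightarrow> b l i = 0"
    using assms unfolding mon_def by blast
  have "t x z ^ p = C ^ p * z ^ (g * A (Suc 0)) * (\<Prod>i<k. x i ^ b (Suc 0) i)" if z: "z \<noteq> 0" for x z
  proof -
    have "z ^ (g * (p * A 0)) = z ^ (g * A (Suc 0))"
      using z by (rule power_cong) (intro cong_scalar_left cong_sym[OF t(5)])
    moreover have "x i ^ (p * b 0 i) = x i ^ b (Suc 0) i" for i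
      by (rule power_cong0) (use cong_sym[OF t(6)[of 0 i]] t(7)[of 0 i] p_pos in auto)
    ultimately show ?thesis
      by (simp add: t(1)[OF z] power_mult_distrib prod_power_distrib mult_ac flip: power_mult)
  qed
  moreover have "(\<Sum>l<E. A (Suc l)) = n * (\<Sum>l<E. p ^ l)"
    using t(3) t(4)[of 0] sum.lessThan_Suc_shift[of A E] by simp
  moreover have "A (Suc l + E) = A (Suc l)" for l by (rule t(4))
  ultimately show ?thesis unfolding mon_def
    by (intro exI[of _ "C ^ p"] exI[of _ "\<lambda>l. A (Suc l)"] exI[of _ "\<lambda>l. b (Suc l)"])
      (use t(2,4-7) in auto)
qed

text \<open>Each factor p of the coefficient pays for p - 1 monomial factors, the rate of
  Stickelberger's theorem; r is the number of factors that remain unpaid.\<close>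

inductive filt :: "nat \<Rightarrow> ((nat \<Rightarrow> 'a) \<Rightarrow> 'a \<Rightarrow> 'a mring) \<Rightarrow> bool" for r where
  filt_zero: "filt r (\<lambda>x z. 0)"
| filt_add: "filt r h \<Longrightarrow> filt r h' \<Longrightarrow> filt r (\<lambda>x z. h x z + h' x z)"
| filt_mon: "mon n t \<Longrightarrow> n \<le> (p - 1) * v + r \<Longrightarrow> filt r (\<lambda>x z. a * of_nat (p ^ v) * tei (t x z))"

lemma filt_const: "filt r (\<lambda>x z. a)"
  using filt_mon[OF mon_1, of 0 r a] by simp

lemma filt_sum: "(\<And>i. i \<in> I \<Longrightarrow> filt r (h i)) \<Longrightarrow> filt r (\<lambda>x z. \<Sum>i\<in>I. h i x z)"
  by (induction I rule: infinite_finite_induct) (auto intro: filt_zero filt_add)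

lemma filt_mult: "filt r h \<Longrightarrow> filt s h' \<Longrightarrow> filt (r + s) (\<lambda>x z. h x z * h' x z)"
proof (induction arbitrary: h' rule: filt.induct)
  case filt_zero
  then show ?case by (simp add: filt.filt_zero)
next
  case (filt_add h1 h2)
  then show ?case by (simp add: distrib_right filt.filt_add)
next
  case (filt_mon n t v a)
  from filt_mon(3) show ?case
  proof (induction rule: filt.induct)
    case filt_zero
    then show ?case by (simp add: filt.filt_zero)
  next
    case (filt_add h1 h2)
    then show ?case by (simp add: distrib_left filt.filt_add)
  next
    case (filt_mon n' t' v' a')
    have "n + n' \<le> (p - 1) * (v + v') + (r + s)"
      using filt_mon \<open>n \<le> (p - 1) * v + r\<close> by (simp add: distrib_left)
    from filt.filt_mon[OF mon_mult[OF \<open>mon n t\<close> filt_mon(1)] this, of "a * a'"]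
    show ?case by (simp add: tei_mult power_add mult_ac)
  qed
qed

lemma filt_cmult: "filt r h \<Longrightarrow> filt r (\<lambda>x z. a * h x z)"
  using filt_mult[OF filt_const[of 0 a]] by simp

lemma filt_diff: "filt r h \<Longrightarrow> filt r h' \<Longrightarrow> filt r (\<lambda>x z. h x z - h' x z)"
  using filt_add[OF _ filt_cmult[of r h' "-1"]] by simp

lemma filt_power: "filt r h \<Longrightarrow> filt (r * j) (\<lambda>x z. h x z ^ j)"
  by (induction j) (auto intro: filt_const filt_mult)

lemma filt_prod:
  "(\<And>i. i \<in> I \<Longrightarrow> filt r (h i)) \<Longrightarrow> filt (card I * r) (\<lambda>x z. \<Prod>i\<in>I. h i x z)"
  by (induction I rule: infinite_finite_induct) (auto intro: filt_const filt_mult)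

lemma filt_p: "filt (r + (p - 1)) h \<Longrightarrow> filt r (\<lambda>x z. of_nat p * h x z)"
proof (induction rule: filt.induct)
  case (filt_mon n t v a)
  from filt.filt_mon[OF filt_mon(1), of "Suc v" r a] filt_mon(2)
  show ?case by (simp add: mult_ac)
qed (auto simp: distrib_left intro: filt.intros)

text \<open>A mixed term of the binomial expansion has weight p = 1 + (p - 1), and its factor p pays
  for the excess p - 1. A single term keeps its count by \<open>mon_power_p\<close>.\<close>

lemma filt_power_p: "filt 1 h \<Longrightarrow> filt 1 (\<lambda>x z. h x z ^ p)"
proof (induction rule: filt.induct)
  case filt_zero
  then show ?case by (simp add: zero_power filt_const)
next
  case (filt_add h h')
  have "filt 1 (\<lambda>x z. of_nat p *
    (\<Sum>i\<in>{0<..<p}. of_nat ((p choose i) div p) * h x z ^ i * h' x z ^ (p - i)))"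
  proof (intro filt_p filt_sum)
    fix i assume "i \<in> {0<..<p}"
    then have eq: "i + (p - i) = 1 + (p - 1)" by simp
    have "filt (i + (p - i)) (\<lambda>x z. of_nat ((p choose i) div p) * (h x z ^ i * h' x z ^ (p - i)))"
      using filt_power[OF filt_add(1), of i] filt_power[OF filt_add(2), of "p - i"]
      by (intro filt_cmult filt_mult) simp_all
    then show "filt (1 + (p - 1)) (\<lambda>x z. of_nat ((p choose i) div p) * h x z ^ i * h' x z ^ (p - i))"
      by (simp only: eq mult.assoc)
  qed
  then show ?case unfolding binomial_p by (intro filt.filt_add filt_add)
next
  case (filt_mon n t v a)
  have "(p - 1) * v \<le> (p - 1) * (v * p)" by (intro mult_le_mono2) simp
  then have "n \<le> (p - 1) * (v * p) + 1" using filt_mon(2) by linarith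
  from filt.filt_mon[OF mon_power_p[OF filt_mon(1)] this, of "a ^ p"]
  show ?case by (simp add: power_mult_distrib power_mult tei_power)
qed

lemma filt_power_p_power: "filt 1 h \<Longrightarrow> filt 1 (\<lambda>x z. h x z ^ (p ^ j))"
  by (induction j) (use filt_power_p in \<open>auto simp: power_Suc2 power_mult simp del: power_Suc\<close>)

text \<open>Summing over all points kills every monomial whose exponents are not divisible by \<open>Q - 1\<close>;
  the survivors have so many factors, counted via all \<open>E\<close> shifts, that their coefficients are
  highly divisible by \<open>p\<close>.\<close>

lemma ipow_sum_mon:
  assumes t: "mon n t" and n: "n \<le> (p - 1) * v + (p - 1) * e"
    and c: "\<And>y. g * k \<le> d * y \<Longrightarrow> c \<le> y"
    and B: "\<And>w. E * c \<le> g * (w + e) \<Longrightarrow> B \<le> w"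
  shows "ipow B (of_nat (p ^ v) * (\<Sum>x\<in>{..<k} \<rightarrow>\<^sub>E UNIV. \<Sum>z\<in>UNIV - {0}. tei (t x z)))"
proof -
  obtain C A b where t:
     "\<And>x z. z \<noteq> 0 \<Longrightarrow> t x z = C * z ^ (g * A 0) * (\<Prod>i<k. x i ^ b 0 i)"
     "\<And>l. (\<Sum>i<k. b l i) = d * A l"
     "(\<Sum>l<E. A l) = n * (\<Sum>l<E. p ^ l)"
     "\<And>l. A (l + E) = A l"
     "\<And>l. [A (Suc l) = p * A l] (mod (Q - 1))"
     "\<And>l i. [b (Suc l) i = p * b l i] (mod (Q - 1))"
     "\<And>l i. b (Suc l) i = 0 \<longleftrightarrow> b l i = 0"
    using t unfolding mon_def by blast
  define S where "S = (\<lambda>i. \<Sum>y\<in>UNIV. tei (y::'a) ^ b 0 i)"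
  define S' where "S' = (\<Sum>z\<in>UNIV - {0::'a}. tei z ^ (g * A 0))"
  have "(\<Sum>x\<in>{..<k} \<rightarrow>\<^sub>E UNIV. \<Sum>z\<in>UNIV - {0}. tei (t x z))
      = (\<Sum>x\<in>{..<k} \<rightarrow>\<^sub>E UNIV. \<Sum>z\<in>UNIV - {0}.
          tei C * (tei z ^ (g * A 0) * (\<Prod>i<k. tei (x i) ^ b 0 i)))"
    by (intro sum.cong) (auto simp: t(1) tei_mult tei_power tei_prod mult.assoc)
  also have "\<dots> = tei C * (S' * (\<Sum>x\<in>{..<k} \<rightarrow>\<^sub>E UNIV. \<Prod>i<k. tei (x i) ^ b 0 i))"
    by (simp add: S'_def sum_distrib_left sum_distrib_right)
  also have "(\<Sum>x\<in>{..<k} \<rightarrow>\<^sub>E UNIV. \<Prod>i<k. tei (x i) ^ b 0 i) = (\<Prod>i<k. S i)"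
    unfolding S_def by (rule prod_sum_PiE[symmetric]) auto
  finally have eq: "(\<Sum>x\<in>{..<k} \<rightarrow>\<^sub>E UNIV. \<Sum>z\<in>UNIV - {0}. tei (t x z)) = tei C * (S' * (\<Prod>i<k. S i))" .
  show ?thesis
  proof (cases "(Q - 1) dvd g * A 0 \<and> (\<forall>i<k. (Q - 1) dvd b 0 i)")
    case False
    then consider "\<not> (Q - 1) dvd g * A 0" | i where "i < k" "\<not> (Q - 1) dvd b 0 i" by blast
    \<comment> \<open>One of the one-variable power sums lies in every power of the kernel.\<close>
    then have "ipow B (S' * (\<Prod>i<k. S i))"
    proof cases
      case 1
      then show ?thesis unfolding S'_def by (intro ipow_mult2 ipow_sum_tei_power) auto
    next
      case 2
      then have "ipow B (S i)" unfolding S_def by (intro ipow_sum_tei_power) auto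
      moreover have "(\<Prod>i<k. S i) = S i * prod S ({..<k} - {i})"
        using 2 by (intro prod.remove) auto
      ultimately show ?thesis by (auto intro: ipow_mult ipow_mult2)
    qed
    then show ?thesis by (auto simp: eq intro: ipow_mult)
  next
    case True
    \<comment> \<open>Variables of exponent zero impose no lower bound on the degree; their sums
      equal Q instead and supply E orders each.\<close>
    define Z where "Z = {i. i < k \<and> b 0 i = 0}"
    have "Z \<subseteq> {..<k}" by (auto simp: Z_def)
    then have card_Z: "card Z \<le> k" and [simp]: "finite Z"
      using card_mono[of "{..<k}" Z] finite_subset by auto
    have dvd_A: "(Q - 1) dvd g * A l" for l
    proof (induction l)
      case (Suc l)
      have "[g * A (Suc l) = g * (p * A l)] (mod (Q - 1))" by (intro cong_scalar_left t(5))
      then show ?case using Suc by (metis cong_dvd_iff dvd_mult mult.left_commute)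
    qed (use True in simp)
    have dvd_b: "(Q - 1) dvd b l i" if "i < k" for l i
    proof (induction l)
      case (Suc l)
      then show ?case using t(6)[of l i] by (metis cong_dvd_iff dvd_mult)
    qed (use True that in simp)
    have zero_b: "b l i = 0 \<longleftrightarrow> b 0 i = 0" for l i
      by (induction l) (auto simp: t(7))
    obtain h where h: "Q - 1 = g * h" using g_dvd by blast
    then have h_pos: "h > 0" using Q_gt_1 by (intro Nat.gr0I) auto
    \<comment> \<open>For every shift, a nonzero exponent is a multiple of Q - 1 = g h, hence at
      least g h. This bounds d \<open>A l\<close> from below by the number of variables outside Z;
      the crude bound g |Z| \<le> d g |Z| accounts for the others.\<close>
    have A_ge: "h * c \<le> A l + h * (g * card Z)" for l
    proof -
      obtain a where "g * A l = g * h * a" using dvd_A[of l] h by auto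
      then have a: "A l = h * a" using g_pos by simp
      have "(k - card Z) * (g * h) = (\<Sum>i\<in>{..<k} - Z. g * h)"
        using \<open>Z \<subseteq> {..<k}\<close> by (simp add: card_Diff_subset)
      also have "\<dots> \<le> (\<Sum>i\<in>{..<k} - Z. b l i)"
      proof (intro sum_mono)
        fix i assume "i \<in> {..<k} - Z"
        then have "i < k" "b l i \<noteq> 0" using zero_b[of l i] by (auto simp: Z_def)
        then show "g * h \<le> b l i" using dvd_b[of i l] h by (auto intro: dvd_imp_le)
      qed
      also have "\<dots> \<le> (\<Sum>i<k. b l i)" by (intro sum_mono2) auto
      also have "\<dots> = d * a * h" by (simp add: t(2) a)
      finally have "(k - card Z) * g * h \<le> d * a * h" by (simp add: mult.assoc)
      then have "(k - card Z) * g \<le> d * a" using h_pos by simp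
      moreover have "g * card Z \<le> d * (g * card Z)" using d_pos by (cases d) auto
      moreover have "g * k = (k - card Z) * g + g * card Z"
        using card_Z by (metis add_mult_distrib2 le_add_diff_inverse2 mult.commute)
      ultimately have "g * k \<le> d * (a + g * card Z)" unfolding distrib_left by linarith
      then have "h * c \<le> h * (a + g * card Z)" using c by simp
      then show ?thesis by (simp add: a distrib_left)
    qed
    have "E * (h * c) = (\<Sum>l<E. h * c)" by simp
    also have "\<dots> \<le> (\<Sum>l<E. A l + h * (g * card Z))" by (intro sum_mono A_ge)
    also have "\<dots> = n * (\<Sum>l<E. p ^ l) + E * (h * (g * card Z))" by (simp add: sum.distrib t(3))
    \<comment> \<open>After summing over all shifts, the factor p - 1 turns the geometric sum into Q
      - 1 = g h, so that (p - 1) h can be cancelled.\<close>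
    finally have "(p - 1) * (E * (h * c)) \<le> (p - 1) * (n * (\<Sum>l<E. p ^ l) + E * (h * (g * card Z)))"
      by (rule mult_le_mono2)
    also have "\<dots> = n * (g * h) + (p - 1) * (E * (h * (g * card Z)))"
      using Q_eq h by (simp add: algebra_simps)
    also have "\<dots> \<le> ((p - 1) * v + (p - 1) * e) * (g * h) + (p - 1) * (E * (h * (g * card Z)))"
      using n by (intro add_mono mult_le_mono1) auto
    finally have *: "(p - 1) * (E * (h * c))
        \<le> ((p - 1) * v + (p - 1) * e) * (g * h) + (p - 1) * (E * (h * (g * card Z)))" .
    have "((p - 1) * h) * (E * c) \<le> ((p - 1) * h) * (g * (v + E * card Z + e))"
      using * by (simp only: distrib_left distrib_right mult_ac add_ac)
    moreover have "(p - 1) * h > 0" using p_ge_2 h_pos by simp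
    ultimately have "E * c \<le> g * (v + E * card Z + e)" by simp
    then have B_le: "B \<le> v + E * card Z" by (rule B)
    have "ipow (\<Sum>i<k. if i \<in> Z then E else 0) (\<Prod>i<k. S i)"
    proof (rule ipow_prod)
      fix i assume "i \<in> {..<k}"
      show "ipow (if i \<in> Z then E else 0) (S i)"
      proof (cases "i \<in> Z")
        case True
        then have "S i = of_nat Q" by (simp add: S_def Z_def card_p)
        then show ?thesis using True ipow_p_power[of E] by simp
      qed simp
    qed simp
    moreover have "(\<Sum>i<k. if i \<in> Z then E else 0) = E * card Z"
      using \<open>Z \<subseteq> {..<k}\<close> by (simp add: Int_absorb1 flip: sum.inter_restrict)
    ultimately have "ipow (v + E * card Z) (of_nat (p ^ v) * (\<Prod>i<k. S i))"
      using ipow_mult_add[OF ipow_p_power[of v]] by simp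
    then have "ipow B (of_nat (p ^ v) * (\<Prod>i<k. S i))" using B_le by (rule ipow_mono)
    then have "ipow B (tei C * S' * (of_nat (p ^ v) * (\<Prod>i<k. S i)))" by (rule ipow_mult)
    then show ?thesis by (simp add: eq mult_ac)
  qed
qed

lemma ipow_sum_filt:
  assumes "filt ((p - 1) * e) h"
    and c: "\<And>y. g * k \<le> d * y \<Longrightarrow> c \<le> y"
    and B: "\<And>w. E * c \<le> g * (w + e) \<Longrightarrow> B \<le> w"
  shows "ipow B (\<Sum>x\<in>{..<k} \<rightarrow>\<^sub>E UNIV. \<Sum>z\<in>UNIV - {0}. h x z)"
  using assms(1)
proof (induction rule: filt.induct)
  case (filt_mon n t v a)
  have "ipow B (a * (of_nat (p ^ v) * (\<Sum>x\<in>{..<k} \<rightarrow>\<^sub>E UNIV. \<Sum>z\<in>UNIV - {0}. tei (t x z))))"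
    using ipow_sum_mon[OF filt_mon c B] by (rule ipow_mult)
  then show ?case by (simp add: sum_distrib_left mult.assoc)
qed (auto simp: sum.distrib intro: ipow_add)

end

section \<open>Counting points by the trace\<close>

locale relative_trace = finite_field_card p "e * m" ty
  for p e m :: nat and ty :: "'a::{field,finite} itself"
begin

abbreviation "q \<equiv> p ^ e"

lemma e_pos: "e > 0" and m_pos: "m > 0"
  using E_pos by simp_all

lemma q_gt_1: "q > 1"
  using p_ge_2 e_pos by (intro one_less_power) auto

definition tr :: "'a \<Rightarrow> 'a" where
  "tr u = (\<Sum>i<m. u ^ (q ^ i))"

lemma power_q_diff: "(x - y :: 'a) ^ (q ^ i) = x ^ (q ^ i) - y ^ (q ^ i)"
proof -
  \<comment> \<open>Writing x as (x - y) + y reduces the difference to additivity of the p-power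
    map, with no sign to treat.\<close>
  have "x ^ (q ^ i) = (\<Sum>b\<in>{True, False}. if b then x - y else y) ^ (q ^ i)" by simp
  also have "\<dots> = (x - y) ^ (q ^ i) + y ^ (q ^ i)"
    unfolding power_mult[symmetric] by (subst sum_power_p_power) simp
  finally show ?thesis by simp
qed

lemma tr_0 [simp]: "tr 0 = 0"
  by (simp add: tr_def zero_power)

lemma tr_diff: "tr (x - y) = tr x - tr y"
  unfolding tr_def by (simp only: power_q_diff sum_subtractf)

lemma power_Qq: "(x :: 'a) ^ (q ^ m) = x"
  using power_Q[of x] by (simp only: power_mult)

lemma tr_power_q_shift: "tr (u ^ q) = tr u"
proof -
  have "tr (u ^ q) = (\<Sum>i<m. u ^ (q ^ Suc i))"
    unfolding tr_def by (simp flip: power_mult)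
  then show ?thesis
    using sum.lessThan_Suc_shift[of "\<lambda>i. u ^ (q ^ i)" m] by (simp add: tr_def power_Qq)
qed

lemma tr_power_q: "tr u ^ q = tr u"
proof -
  have "tr u ^ q = (\<Sum>i<m. (u ^ (q ^ i)) ^ q)" unfolding tr_def by (rule sum_power_p_power)
  also have "\<dots> = tr (u ^ q)" unfolding tr_def by (simp flip: power_mult add: mult.commute)
  finally show ?thesis by (simp only: tr_power_q_shift)
qed

lemma tr_mult_fixed:
  assumes "c ^ q = c"
  shows "tr (c * u) = c * tr u"
proof -
  have "c ^ (q ^ i) = c" for i
    by (induction i) (simp_all add: assms power_mult)
  then show ?thesis by (simp add: tr_def power_mult_distrib sum_distrib_left)
qed

text \<open>The trace is a polynomial function of degree at most \<open>q ^ (m - 1)\<close>; the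
  polynomial is nonzero because its linear coefficient is 1.\<close>

lemma card_tr_kernel_le: "card {u. tr u = 0} \<le> q ^ (m - 1)"
proof -
  define P :: "'a poly" where "P = (\<Sum>i<m. monom 1 (q ^ i))"
  have "coeff P (q ^ 0) = (\<Sum>i<m. if i = 0 then 1 else 0)"
    unfolding P_def coeff_sum coeff_monom
    using q_gt_1 by (intro sum.cong) (auto dest: power_inject_exp[THEN iffD1, rotated])
  then have "P \<noteq> 0" using m_pos by auto
  have "card {u. tr u = 0} = card {u. poly P u = 0}"
    by (simp add: P_def tr_def poly_sum poly_monom)
  also have "\<dots> \<le> degree P" using \<open>P \<noteq> 0\<close> by (rule card_poly_roots_bound)
  also have "\<dots> \<le> q ^ (m - 1)" unfolding P_def
  proof (rule degree_sum_le)
    fix i assume "i \<in> {..<m}"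
    then have "q ^ i \<le> q ^ (m - 1)" using q_gt_1 by (intro power_increasing) auto
    then show "degree (monom (1::'a) (q ^ i)) \<le> q ^ (m - 1)"
      using degree_monom_le order_trans by blast
  qed simp
  finally show ?thesis .
qed

lemma card_fixed_le: "card {y::'a. y ^ q = y} \<le> q"
proof -
  define P :: "'a poly" where "P = monom 1 q - monom 1 1"
  have "coeff P q = 1" using q_gt_1 by (simp add: P_def)
  then have "P \<noteq> 0" by auto
  have "card {y::'a. y ^ q = y} = card {y. poly P y = 0}"
    by (simp add: P_def poly_monom)
  also have "\<dots> \<le> degree P" using \<open>P \<noteq> 0\<close> by (rule card_poly_roots_bound)
  also have "\<dots> \<le> q" unfolding P_def
    using q_gt_1 by (intro degree_diff_le) (auto intro: order_trans[OF degree_monom_le])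
  finally show ?thesis .
qed

text \<open>The additive map y^q - y has at most q elements in its kernel, and its image lies in the
  trace kernel, of size at most q^(m-1). The product of the two sizes is q^m, so all bounds are
  attained.\<close>

lemma
  shows card_artin_schreier: "card {y. y ^ q - y = u} = (if tr u = 0 then q else 0)"
    and card_tr_kernel: "card {u. tr u = 0} = q ^ (m - 1)"
proof -
  define f where "f = (\<lambda>y::'a. y ^ q - y)"
  have ker: "range f \<subseteq> {u. tr u = 0}"
    by (auto simp: f_def tr_diff tr_power_q_shift)
  have f_diff: "f (x - y) = f x - f y" for x y
    using power_q_diff[of x y 1] by (simp add: f_def)
  have f_add: "f (x + y) = f x + f y" for x y
    using f_diff[of "x + y" y] by simp
  have fibre: "card {y. f y = u} = card {y::'a. y ^ q = y}" if u: "u \<in> range f" for u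
  proof -
    obtain y0 where y0: "u = f y0" using u by blast
    have "bij_betw (\<lambda>y. y - y0) {y. f y = u} {y. f y = 0}"
      by (rule bij_betwI[of _ _ _ "\<lambda>y. y + y0"]) (auto simp: f_diff f_add y0)
    then show ?thesis using bij_betw_same_card by (fastforce simp: f_def)
  qed
  have "q ^ (m - 1) * q = CARD('a)"
    using m_pos by (simp add: card_p power_mult flip: power_Suc2)
  also have "\<dots> = (\<Sum>u\<in>range f. card {y. f y = u})"
    using sum.group[of UNIV "range f" f "\<lambda>_. 1::nat"] by simp
  also have "\<dots> = card (range f) * card {y::'a. y ^ q = y}" by (simp add: fibre)
  finally have eq: "q ^ (m - 1) * q = card (range f) * card {y::'a. y ^ q = y}" .
  have le: "card (range f) \<le> card {u. tr u = 0}" using ker by (intro card_mono) auto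
  have K: "card {y::'a. y ^ q = y} = q"
  proof (rule antisym[OF card_fixed_le], rule ccontr)
    assume "\<not> q \<le> card {y::'a. y ^ q = y}"
    then have "card (range f) * card {y::'a. y ^ q = y} < card (range f) * q"
      by (intro mult_strict_left_mono) (auto simp: card_gt_0_iff)
    also have "\<dots> \<le> q ^ (m - 1) * q"
      using le card_tr_kernel_le by (intro mult_le_mono1) linarith
    finally show False using eq by simp
  qed
  then have "card (range f) = q ^ (m - 1)" using eq q_gt_1 by simp
  with le card_tr_kernel_le show *: "card {u. tr u = 0} = q ^ (m - 1)" by simp
  have "range f = {u. tr u = 0}"
    by (rule card_subset_eq[OF _ ker]) (simp_all add: * \<open>card (range f) = q ^ (m - 1)\<close>)
  then show "card {y. y ^ q - y = u} = (if tr u = 0 then q else 0)"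
    using fibre[of u] K by (auto simp: f_def)
qed

definition N_tr :: "nat \<Rightarrow> nat \<Rightarrow> ((nat \<Rightarrow> nat) \<Rightarrow> 'a) \<Rightarrow> nat" where
  "N_tr k d c = card {x \<in> {..<k} \<rightarrow>\<^sub>E UNIV. tr (peval k d c x) = 0}"

lemma N_AS_eq: "N_AS q k d c = q * N_tr k d c"
proof -
  let ?X = "{..<k} \<rightarrow>\<^sub>E (UNIV::'a set)"
  have fin: "finite ?X" by (intro finite_PiE) auto
  have "{(x, y). x \<in> ?X \<and> peval k d c x = y ^ q - y}
      = Sigma ?X (\<lambda>x. {y. y ^ q - y = peval k d c x})"
    by (simp only: set_eq_iff split_paired_All mem_Collect_eq prod.case mem_Sigma_iff
        eq_commute[of "peval k d c x" for x] simp_thms)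
  then have "N_AS q k d c = card (Sigma ?X (\<lambda>x. {y. y ^ q - y = peval k d c x}))"
    unfolding N_AS_def by (rule arg_cong)
  also have "\<dots> = (\<Sum>x\<in>?X. card {y. y ^ q - y = peval k d c x})"
    using fin by (intro card_SigmaI) simp_all
  also have "\<dots> = (\<Sum>x\<in>?X. if tr (peval k d c x) = 0 then q else 0)"
    by (simp add: card_artin_schreier)
  also have "\<dots> = q * N_tr k d c"
    using fin by (simp add: N_tr_def flip: sum.inter_filter)
  finally show ?thesis .
qed

text \<open>Points are extensional functions on \<open>{..<k}\<close>, hence the
  \<open>restrict\<close> around the scaled point.\<close>

lemma peval_scale: "peval k d c (restrict (\<lambda>i. w * x i) {..<k}) = w ^ d * peval k d c x"
  unfolding peval_def sum_distrib_left
proof (rule sum.cong[OF refl])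
  fix \<alpha> assume "\<alpha> \<in> hmonos k d"
  then have "(\<Prod>i<k. w ^ \<alpha> i) = w ^ d" by (simp add: hmonos_def flip: power_sum)
  then show "c \<alpha> * (\<Prod>i<k. restrict (\<lambda>i. w * x i) {..<k} i ^ \<alpha> i) = w ^ d * (c \<alpha> * (\<Prod>i<k. x i ^ \<alpha> i))"
    by (simp add: power_mult_distrib prod.distrib)
qed

lemma q1_dvd: "q - 1 dvd p ^ (e * m) - 1"
proof -
  have "int q - 1 dvd int q ^ m - 1" by (simp add: power_diff_1_eq)
  then have "int (q - 1) dvd int (p ^ (e * m) - 1)"
    using q_gt_1 Q_gt_1 by (simp add: of_nat_diff power_mult)
  then show ?thesis by (simp only: int_dvd_int_iff)
qed

text \<open>Up to a factor from the subfield of order \<open>q\<close>, which commutes with the trace,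
  \<open>z\<^sup>g\<close> is a \<open>d\<close>-th power and hence absorbed by rescaling \<open>x\<close>.\<close>

lemma N_tr_scale:
  assumes "d > 0" and z: "z \<noteq> 0" and g: "g = gcd d ((p ^ (e * m) - 1) div (q - 1))"
  shows "card {x \<in> {..<k} \<rightarrow>\<^sub>E UNIV. tr (z ^ g * peval k d c x) = 0} = N_tr k d c"
proof -
  define D where "D = (p ^ (e * m) - 1) div (q - 1)"
  \<comment> \<open>Bezout gives (z^s)^d = z^(D t) z^g, and z^(D t) lies in the subfield of order q
    because (q - 1) D = Q - 1.\<close>
  obtain s t where st: "d * s = D * t + g"
    using bezout_nat[of d D] assms(1) by (auto simp: g D_def)
  define w where "w = z ^ s"
  define a where "a = z ^ (D * t)"
  have "w \<noteq> 0" "a \<noteq> 0" using z by (simp_all add: w_def a_def)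
  have wd: "w ^ d = a * z ^ g"
    by (simp add: w_def a_def mult.commute[of s] st power_add flip: power_mult)
  have "a ^ (q - 1) = 1"
  proof -
    have "a ^ (q - 1) = (z ^ ((q - 1) * D)) ^ t" by (simp add: a_def mult_ac flip: power_mult)
    also have "(q - 1) * D = p ^ (e * m) - 1" using q1_dvd by (simp add: D_def)
    finally show ?thesis by (simp only: power_Q1[OF z] power_one)
  qed
  have "a ^ Suc (q - 1) = a" by (simp only: power_Suc \<open>a ^ (q - 1) = 1\<close> mult_1_right)
  moreover have "Suc (q - 1) = q" using q_gt_1 by simp
  ultimately have aq: "a ^ q = a" by (simp only:)
  have iff: "tr (peval k d c (restrict (\<lambda>i. w * x i) {..<k})) = 0 \<longleftrightarrow> tr (z ^ g * peval k d c x) = 0" for x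
    using \<open>a \<noteq> 0\<close> by (simp add: peval_scale wd mult.assoc tr_mult_fixed[OF aq])
  have "bij_betw (\<lambda>x. restrict (\<lambda>i. w * x i) {..<k})
    {x \<in> {..<k} \<rightarrow>\<^sub>E UNIV. tr (z ^ g * peval k d c x) = 0}
    {x \<in> {..<k} \<rightarrow>\<^sub>E UNIV. tr (peval k d c x) = 0}"
  proof (rule bij_betwI[of _ _ _ "\<lambda>x. restrict (\<lambda>i. x i / w) {..<k}"])
    have inv: "restrict (\<lambda>i. w * restrict (\<lambda>i. x i / w) {..<k} i) {..<k} = x"
      if "x \<in> {..<k} \<rightarrow>\<^sub>E UNIV" for x
      using that \<open>w \<noteq> 0\<close> by (auto simp: fun_eq_iff PiE_def extensional_def)
    then show "restrict (\<lambda>i. w * restrict (\<lambda>i. x i / w) {..<k} i) {..<k} = x"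
      if "x \<in> {x \<in> {..<k} \<rightarrow>\<^sub>E UNIV. tr (peval k d c x) = 0}" for x using that by blast
    show "restrict (\<lambda>i. restrict (\<lambda>i. w * x i) {..<k} i / w) {..<k} = x"
      if "x \<in> {x \<in> {..<k} \<rightarrow>\<^sub>E UNIV. tr (z ^ g * peval k d c x) = 0}" for x
      using that \<open>w \<noteq> 0\<close> by (auto simp: fun_eq_iff PiE_def extensional_def)
    show "(\<lambda>x. restrict (\<lambda>i. w * x i) {..<k}) \<in> {x \<in> {..<k} \<rightarrow>\<^sub>E UNIV. tr (z ^ g * peval k d c x) = 0}
      \<rightarrow> {x \<in> {..<k} \<rightarrow>\<^sub>E UNIV. tr (peval k d c x) = 0}"
      by (auto simp: iff)
    show "(\<lambda>x. restrict (\<lambda>i. x i / w) {..<k}) \<in> {x \<in> {..<k} \<rightarrow>\<^sub>E UNIV. tr (peval k d c x) = 0}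
      \<rightarrow> {x \<in> {..<k} \<rightarrow>\<^sub>E UNIV. tr (z ^ g * peval k d c x) = 0}"
    proof
      fix x assume x: "x \<in> {x \<in> {..<k} \<rightarrow>\<^sub>E UNIV. tr (peval k d c x) = 0}"
      then have "tr (z ^ g * peval k d c (restrict (\<lambda>i. x i / w) {..<k})) = 0"
        by (subst iff[symmetric], subst inv) auto
      then show "restrict (\<lambda>i. x i / w) {..<k} \<in> {x \<in> {..<k} \<rightarrow>\<^sub>E UNIV. tr (z ^ g * peval k d c x) = 0}"
        by simp
    qed
  qed
  then show ?thesis unfolding N_tr_def by (rule bij_betw_same_card)
qed

text \<open>Modulo order B, the indicator of tr (z^g f x) = 0 is 1 - h^(q-1) with h of weight 1. Its
  sum over x and z is (Q - 1) \<open>N_tr k d c\<close> on one side and vanishes to order B on the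
  other. C and B enter through their bounding properties, which keeps ceilings out.\<close>

lemma power_dvd_N_tr:
  assumes d: "d > 0" and g: "g = gcd d ((p ^ (e * m) - 1) div (q - 1))"
    and C: "\<And>y. g * k \<le> d * y \<Longrightarrow> C \<le> y"
    and B: "\<And>w. e * m * C \<le> g * (w + e) \<Longrightarrow> B \<le> w"
  shows "p ^ B dvd N_tr k d c"
proof -
  let ?X = "{..<k} \<rightarrow>\<^sub>E (UNIV::'a set)"
  have g_dvd: "g dvd p ^ (e * m) - 1"
  proof -
    have "(p ^ (e * m) - 1) div (q - 1) dvd p ^ (e * m) - 1" using q1_dvd by (metis dvd_div_mult_self dvd_triv_left)
    then show ?thesis unfolding g using dvd_trans gcd_dvd2 by blast
  qed
  interpret weighted_monomials p "e * m" ty k d g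
    by unfold_locales (use d g_dvd in auto)
  define t where "t = (\<lambda>\<alpha> x z. c \<alpha> * z ^ g * (\<Prod>i<k. x i ^ \<alpha> i))"
  define h0 where "h0 = (\<lambda>x z. \<Sum>i<m. (\<Sum>\<alpha>\<in>hmonos k d. tei (t \<alpha> x z) ^ (p ^ (e * i))))"
  \<comment> \<open>\<open>h0\<close> lifts the trace U. Raising it to the power Q^B leaves its
    residue unchanged and makes it agree with [U] to order B.\<close>
  define h where "h = (\<lambda>x z. h0 x z ^ (p ^ (e * m * B)))"
  define U where "U = (\<lambda>x z. tr (z ^ g * peval k d c x))"
  have "filt 1 (\<lambda>x z. tei (t \<alpha> x z))" if "\<alpha> \<in> hmonos k d" for \<alpha>
    using filt_mon[OF mon_base[of \<alpha> "c \<alpha>"], where v = 0 and a = 1 and r = 1] that by (simp add: t_def hmonos_def)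
  then have "filt 1 h0" unfolding h0_def by (intro filt_sum filt_power_p_power)
  then have "filt 1 h" unfolding h_def by (rule filt_power_p_power)
  \<comment> \<open>In base p, q - 1 has e digits equal to p - 1. As p-power exponents cost nothing,
    h^(q-1) has weight (p - 1) e instead of q - 1.\<close>
  have q1: "q - 1 = (\<Sum>i<e. p ^ i * (p - 1))"
    using power_diff_1_eq[of "int p" e] q_gt_1 p_ge_2
    by (simp flip: of_nat_eq_iff[where 'a = int] add: of_nat_diff sum_distrib_left mult.commute)
  have "filt (card {..<e} * (1 * (p - 1))) (\<lambda>x z. \<Prod>i<e. (h x z ^ (p ^ i)) ^ (p - 1))"
    by (intro filt_prod filt_power filt_power_p_power \<open>filt 1 h\<close>)
  then have "filt ((p - 1) * e) (\<lambda>x z. h x z ^ (q - 1))"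
    unfolding q1 by (simp add: power_sum power_mult mult.commute)
  then have "filt ((p - 1) * e) (\<lambda>x z. 1 - h x z ^ (q - 1))"
    by (intro filt_diff filt_const)
  then have sum_h: "ipow B (\<Sum>x\<in>?X. \<Sum>z\<in>UNIV - {0}. 1 - h x z ^ (q - 1))"
    using C B by (rule ipow_sum_filt)
  have res: "residue (h0 x z) = U x z" for x z
  proof -
    have "residue (h0 x z) = (\<Sum>i<m. \<Sum>\<alpha>\<in>hmonos k d. t \<alpha> x z ^ (q ^ i))"
      by (simp add: h0_def residue_sum residue_power power_mult)
    also have "\<dots> = (\<Sum>i<m. (\<Sum>\<alpha>\<in>hmonos k d. t \<alpha> x z) ^ (q ^ i))"
      unfolding power_mult[symmetric] by (simp add: sum_power_p_power)
    also have "(\<Sum>\<alpha>\<in>hmonos k d. t \<alpha> x z) = z ^ g * peval k d c x"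
      by (simp add: t_def peval_def sum_distrib_left mult_ac)
    finally show ?thesis by (simp add: tr_def U_def)
  qed
  have ind: "ipow B (of_bool (U x z = 0) - (1 - h x z ^ (q - 1)))" for x z
  proof -
    have fix_u: "U x z ^ (p ^ (e * m * j)) = U x z" for j
    proof (induction j)
      case (Suc j)
      have "U x z ^ (p ^ (e * m * Suc j)) = (U x z ^ (p ^ (e * m))) ^ (p ^ (e * m * j))"
        by (simp only: mult_Suc_right power_add power_mult)
      then show ?case using Suc by simp
    qed simp
    have "ipow (Suc (e * m * B)) (tei (U x z) ^ (p ^ (e * m * B)) - h x z)"
      unfolding h_def by (rule ipow_power_p_power_cong) (simp add: res)
    then have "ipow (Suc (e * m * B)) (tei (U x z) - h x z)"
      by (simp add: fix_u flip: tei_power)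
    moreover have "B \<le> Suc (e * m * B)" using e_pos m_pos by (cases "e * m") auto
    ultimately have "ipow B (tei (U x z) - h x z)" by (rule ipow_mono)
    then have "ipow B (tei (U x z) ^ (q - 1) - h x z ^ (q - 1))" by (rule ipow_power_diff)
    then have 1: "ipow B (h x z ^ (q - 1) - tei (U x z ^ (q - 1)))"
      using ipow_uminus by (fastforce simp: tei_power)
    \<comment> \<open>U lies in the subfield of order q, so U^(q-1) is 0 or 1; for U = 0 the class
      [0] is negligible to every order.\<close>
    have 2: "ipow B (of_bool (U x z = 0) - (1 - tei (U x z ^ (q - 1))))"
    proof (cases "U x z = 0")
      case True
      then show ?thesis using q_gt_1 by (simp add: zero_power ipow_tei_0)
    next
      case False
      have "U x z ^ Suc (q - 1) = U x z" using tr_power_q q_gt_1 by (simp add: U_def)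
      then have "U x z * U x z ^ (q - 1) = U x z" by (simp only: power_Suc)
      then have "U x z ^ (q - 1) = 1" using False by simp
      then show ?thesis using False by (simp del: One_nat_def)
    qed
    show ?thesis using ipow_add[OF 1 2] by (simp add: algebra_simps)
  qed
  have "ipow B ((\<Sum>x\<in>?X. \<Sum>z\<in>UNIV - {0}. of_bool (U x z = 0) - (1 - h x z ^ (q - 1)))
      + (\<Sum>x\<in>?X. \<Sum>z\<in>UNIV - {0}. 1 - h x z ^ (q - 1)))"
    by (intro ipow_add[OF _ sum_h] ipow_sum ind)
  also have "(\<Sum>x\<in>?X. \<Sum>z\<in>UNIV - {0}. of_bool (U x z = 0) - (1 - h x z ^ (q - 1)))
      + (\<Sum>x\<in>?X. \<Sum>z\<in>UNIV - {0}. 1 - h x z ^ (q - 1))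
      = (\<Sum>x\<in>?X. \<Sum>z\<in>UNIV - {0}. of_bool (U x z = 0))"
    by (simp flip: sum.distrib)
  also have "\<dots> = (\<Sum>z\<in>UNIV - {0}. \<Sum>x\<in>?X. of_bool (U x z = 0))" by (rule sum.swap)
  also have "\<dots> = (\<Sum>z\<in>UNIV - {0::'a}. of_nat (N_tr k d c))"
  proof (intro sum.cong refl)
    fix z :: 'a assume z: "z \<in> UNIV - {0}"
    have "finite ?X" by (intro finite_PiE) auto
    then have "(\<Sum>x\<in>?X. of_bool (U x z = 0)) = (of_nat (card {x \<in> ?X. U x z = 0}) :: 'a mring)"
      by (simp add: Int_def)
    also have "card {x \<in> ?X. U x z = 0} = N_tr k d c"
      unfolding U_def using N_tr_scale[OF d _ g] z by simp
    finally show "(\<Sum>x\<in>?X. of_bool (U x z = 0)) = (of_nat (N_tr k d c) :: 'a mring)" .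
  qed
  also have "\<dots> = of_int (int ((p ^ (e * m) - 1) * N_tr k d c))"
    by (simp add: card_Diff_singleton card_p)
  finally have "int p ^ B dvd int ((p ^ (e * m) - 1) * N_tr k d c)" by (rule ipow_of_int_dvd)
  then have "p ^ B dvd (p ^ (e * m) - 1) * N_tr k d c"
    by (metis int_dvd_int_iff of_nat_power)
  moreover have "coprime (p ^ B) (p ^ (e * m) - 1)"
  proof -
    have "\<not> p dvd p ^ (e * m) - 1"
    proof
      assume "p dvd p ^ (e * m) - 1"
      moreover have "p dvd p ^ (e * m)" using E_pos by (intro dvd_power) auto
      ultimately have "p dvd 1" using Q_gt_1 by (metis dvd_diffD1 less_imp_le)
      then show False using p_ge_2 by simp
    qed
    then show ?thesis using prime_p by (simp add: prime_imp_coprime)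
  qed
  ultimately show ?thesis by (simp add: coprime_dvd_mult_right_iff)
qed

end

section \<open>Sharpness\<close>

lemma card_compl_points:
  assumes "finite X"
  shows "int (card {x \<in> X. P x}) = int (card X) - int (card {x \<in> X. \<not> P x})"
proof -
  have "card X = card ({x \<in> X. P x} \<union> {x \<in> X. \<not> P x})" by (intro arg_cong[of _ _ card]) auto
  also have "\<dots> = card {x \<in> X. P x} + card {x \<in> X. \<not> P x}"
    using assms by (intro card_Un_disjoint) auto
  finally show ?thesis by simp
qed

lemma finite_hmonos: "finite (hmonos k d)"
proof (rule finite_subset)
  show "hmonos k d \<subseteq> {\<alpha>. \<forall>i. (i \<in> {..<k} \<longrightarrow> \<alpha> i \<in> {..d}) \<and> (i \<notin> {..<k} \<longrightarrow> \<alpha> i = 0)}"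
    using member_le_sum[of _ "{..<k}"] by (force simp: hmonos_def)
qed (intro finite_set_of_finite_funs; simp)

context finite_field_card
begin

lemma finite_points: "finite ({..<k::nat} \<rightarrow>\<^sub>E (UNIV::'a set))"
  by (intro finite_PiE) auto

lemma card_points: "card ({..<k::nat} \<rightarrow>\<^sub>E (UNIV::'a set)) = Q ^ k"
  by (simp add: card_PiE card_p)

lemma card_prod_neq_0:
  assumes "finite B"
  shows "card {y \<in> B \<rightarrow>\<^sub>E UNIV. (\<Prod>i\<in>B. y i) \<noteq> (0::'a)} = (Q - 1) ^ card B"
proof -
  have "{y \<in> B \<rightarrow>\<^sub>E UNIV. (\<Prod>i\<in>B. y i) \<noteq> (0::'a)} = B \<rightarrow>\<^sub>E (UNIV - {0})"
    using assms by (auto simp: PiE_def Pi_def)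
  then show ?thesis using assms by (simp add: card_PiE card_Diff_singleton card_p)
qed

lemma card_prod_eq_0:
  assumes "finite B"
  shows "int (card {y \<in> B \<rightarrow>\<^sub>E UNIV. (\<Prod>i\<in>B. y i) = (0::'a)}) = int Q ^ card B - (int Q - 1) ^ card B"
proof -
  have "finite (B \<rightarrow>\<^sub>E (UNIV::'a set))" using assms by (intro finite_PiE) auto
  from card_compl_points[OF this, of "\<lambda>y. (\<Prod>i\<in>B. y i) = 0"] show ?thesis
    using assms Q_gt_1 card_prod_neq_0[OF assms]
    by (simp add: card_PiE card_p of_nat_diff)
qed

text \<open>Rescaling one coordinate b identifies the fibres over all Q - 1 nonzero values, and
  together they contain the points with nonzero coordinates.\<close>

lemma card_prod_eq:
  assumes "finite B" and "B \<noteq> {}" and "v \<noteq> (0::'a)"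
  shows "card {y \<in> B \<rightarrow>\<^sub>E UNIV. (\<Prod>i\<in>B. y i) = v} = (Q - 1) ^ (card B - 1)"
proof -
  let ?F = "\<lambda>v. {y \<in> B \<rightarrow>\<^sub>E UNIV. (\<Prod>i\<in>B. y i) = (v::'a)}"
  obtain b where b: "b \<in> B" using assms(2) by blast
  have fin: "finite (?F v)" for v using assms(1) by (intro finite_subset[OF _ finite_PiE]) auto
  have upd: "(\<Prod>i\<in>B. (y(b := y b * c)) i) = c * (\<Prod>i\<in>B. y i)" for y :: "'b \<Rightarrow> 'a" and c
  proof -
    have "(\<Prod>i\<in>B. (y(b := y b * c)) i) = y b * c * (\<Prod>i\<in>B - {b}. y i)"
      by (simp add: prod.remove[OF assms(1) b])
    then show ?thesis by (simp add: prod.remove[OF assms(1) b, of y] mult_ac)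
  qed
  have mem: "y(b := v) \<in> B \<rightarrow>\<^sub>E UNIV" if "y \<in> B \<rightarrow>\<^sub>E UNIV" for y and v :: 'a
    using PiE_fun_upd[OF UNIV_I that, where x = b] by (simp add: insert_absorb[OF b])
  have eq: "card (?F w) = card (?F 1)" if "w \<noteq> 0" for w
  proof (rule bij_betw_same_card, rule bij_betwI[of "\<lambda>y. y(b := y b * inverse w)" _ _ "\<lambda>y. y(b := y b * w)"])
    show "(\<lambda>y. y(b := y b * inverse w)) \<in> ?F w \<rightarrow> ?F 1"
      by (rule Pi_I) (simp del: fun_upd_apply add: mem upd that)
    show "(\<lambda>y. y(b := y b * w)) \<in> ?F 1 \<rightarrow> ?F w"
      by (rule Pi_I) (simp del: fun_upd_apply add: mem upd)
  qed (use that in auto)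
  have "{y \<in> B \<rightarrow>\<^sub>E UNIV. (\<Prod>i\<in>B. y i) \<noteq> (0::'a)} = (\<Union>w\<in>UNIV - {0}. ?F w)" by auto
  then have "(Q - 1) ^ card B = card (\<Union>w\<in>UNIV - {0}. ?F w)"
    by (simp only: card_prod_neq_0[OF assms(1), symmetric])
  also have "\<dots> = (\<Sum>w\<in>UNIV - {0}. card (?F w))"
  proof (rule card_UN_disjoint)
    show "\<forall>w\<in>UNIV - {0}. finite (?F w)" using fin by blast
  qed (simp, blast)
  also have "\<dots> = (\<Sum>w\<in>UNIV - {0::'a}. card (?F 1))" by (intro sum.cong refl eq) simp
  also have "\<dots> = (Q - 1) * card (?F 1)" by (simp add: card_Diff_singleton card_p)
  also have "card B = Suc (card B - 1)" using assms(1,2) by (simp add: card_gt_0_iff)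
  finally have "(Q - 1) * card (?F 1) = (Q - 1) ^ Suc (card B - 1)" by (rule sym)
  then have mult_eq: "(Q - 1) * card (?F 1) = (Q - 1) * (Q - 1) ^ (card B - 1)"
    by (simp only: power_Suc)
  have "Q - 1 \<noteq> 0" using Q_gt_1 by simp
  from mult_left_cancel[OF this, THEN iffD1, OF mult_eq]
  have "card (?F 1) = (Q - 1) ^ (card B - 1)" .
  then show ?thesis by (simp only: eq[OF assms(3)])
qed

definition zeros :: "nat \<Rightarrow> (nat \<Rightarrow> nat) set \<Rightarrow> nat" where
  "zeros k S = card {x \<in> {..<k} \<rightarrow>\<^sub>E UNIV. (\<Sum>\<alpha>\<in>S. \<Prod>i<k. x i ^ \<alpha> i) = (0::'a)}"

lemma p_dvd_Q: "int p dvd int Q"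
  using E_pos by (simp add: dvd_power)

lemma not_dvd_Q1_power: "\<not> int p dvd (int Q - 1) ^ n"
proof
  assume "int p dvd (int Q - 1) ^ n"
  then have "int p dvd int Q - 1" using prime_p by (simp add: prime_dvd_power_int)
  then have "int p dvd 1" using p_dvd_Q by (metis diff_diff_eq2 add_diff_cancel_left' dvd_diff)
  then show False using p_ge_2 by simp
qed

lemma zeros_monomial:
  assumes "0 < s" "s \<le> k" "s \<le> d"
  shows "\<exists>\<alpha>\<in>hmonos k d. int (zeros k {\<alpha>}) = int Q ^ (k - s) * (int Q ^ s - (int Q - 1) ^ s)"
proof -
  \<comment> \<open>The first s variables, with the surplus degree put on the first one. The
    monomial vanishes exactly where one of these variables does.\<close>
  define \<alpha> where "\<alpha> = (\<lambda>i. if i = 0 then d - s + 1 else if i < s then 1 else 0 :: nat)"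
  have "(\<Sum>i<k. \<alpha> i) = (\<Sum>i<s. \<alpha> i)"
    by (rule sum.mono_neutral_right) (use assms in \<open>auto simp: \<alpha>_def\<close>)
  also have "\<dots> = \<alpha> 0 + (\<Sum>i\<in>{..<s} - {0}. \<alpha> i)"
    using assms by (intro sum.remove) auto
  also have "(\<Sum>i\<in>{..<s} - {0}. \<alpha> i) = (\<Sum>i\<in>{..<s} - {0}. 1)"
    by (intro sum.cong) (auto simp: \<alpha>_def)
  also have "\<alpha> 0 + \<dots> = d" using assms by (simp add: \<alpha>_def card_Diff_singleton)
  finally have mem: "\<alpha> \<in> hmonos k d" using assms by (auto simp: hmonos_def \<alpha>_def)
  have \<alpha>_pos: "0 < \<alpha> i \<longleftrightarrow> i < s" for i using assms by (auto simp: \<alpha>_def)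
  have nz: "(\<Prod>i<k. x i ^ \<alpha> i) \<noteq> 0 \<longleftrightarrow> (\<forall>i<s. x i \<noteq> 0)" for x :: "nat \<Rightarrow> 'a"
  proof -
    have "(\<Prod>i<k. x i ^ \<alpha> i) \<noteq> 0 \<longleftrightarrow> (\<forall>i<k. x i ^ \<alpha> i \<noteq> 0)" by auto
    also have "\<dots> \<longleftrightarrow> (\<forall>i<k. i < s \<longrightarrow> x i \<noteq> 0)"
      by (intro all_cong1 imp_cong refl) (auto simp: \<alpha>_pos)
    also have "\<dots> \<longleftrightarrow> (\<forall>i<s. x i \<noteq> 0)" using assms(2) by auto
    finally show ?thesis .
  qed
  have "{x \<in> {..<k} \<rightarrow>\<^sub>E UNIV. (\<Prod>i<k. x i ^ \<alpha> i) \<noteq> (0::'a)}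
      = (\<Pi>\<^sub>E i\<in>{..<k}. if i < s then UNIV - {0} else UNIV)"
  proof (rule set_eqI)
    fix x :: "nat \<Rightarrow> 'a"
    have "(\<forall>i<s. x i \<noteq> 0) \<longleftrightarrow> (\<forall>i\<in>{..<k}. x i \<in> (if i < s then UNIV - {0} else UNIV))"
      using assms(2) by (auto split: if_splits)
    then show "x \<in> {x \<in> {..<k} \<rightarrow>\<^sub>E UNIV. (\<Prod>i<k. x i ^ \<alpha> i) \<noteq> 0} \<longleftrightarrow>
        x \<in> (\<Pi>\<^sub>E i\<in>{..<k}. if i < s then UNIV - {0} else UNIV)"
      unfolding mem_Collect_eq nz PiE_iff by blast
  qed
  then have "card {x \<in> {..<k} \<rightarrow>\<^sub>E UNIV. (\<Prod>i<k. x i ^ \<alpha> i) \<noteq> (0::'a)}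
      = (\<Prod>i<k. if i < s then Q - 1 else Q)"
    by (simp add: card_PiE card_Diff_singleton card_p if_distrib[of card] cong: if_cong)
  also have "\<dots> = (\<Prod>i\<in>{..<s} \<union> {s..<k}. if i < s then Q - 1 else Q)"
    using assms by (intro prod.cong) auto
  also have "\<dots> = (\<Prod>i\<in>{..<s}. Q - 1) * (\<Prod>i\<in>{s..<k}. Q)"
    by (subst prod.union_disjoint) (auto intro!: arg_cong2[of _ _ _ _ times] prod.cong)
  finally have "card {x \<in> {..<k} \<rightarrow>\<^sub>E UNIV. (\<Prod>i<k. x i ^ \<alpha> i) \<noteq> (0::'a)} = (Q - 1) ^ s * Q ^ (k - s)"
    by simp
  then have "int (zeros k {\<alpha>}) = int Q ^ k - (int Q - 1) ^ s * int Q ^ (k - s)"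
    using card_compl_points[OF finite_points, of k "\<lambda>x. (\<Prod>i<k. x i ^ \<alpha> i) = (0::'a)"] Q_gt_1
    by (simp add: zeros_def card_points of_nat_diff)
  also have "int Q ^ k = int Q ^ (k - s) * int Q ^ s" using assms by (simp flip: power_add)
  finally show ?thesis using mem by (intro bexI[of _ \<alpha>]) (simp_all add: algebra_simps)
qed

text \<open>\<beta> is the product of d fresh variables. For fixed old variables it must take the
  value -F, and the number of ways depends only on whether F vanishes.\<close>

lemma zeros_add_block:
  assumes S: "S \<subseteq> hmonos k d" and "d > 0"
  defines "\<beta> \<equiv> \<lambda>i. if i \<in> {k..<k + d} then 1 else 0 :: nat"
  shows "int (zeros (k + d) (insert \<beta> S)) = int (zeros k S) * (int Q ^ d - (int Q - 1) ^ d)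
    + (int Q ^ k - int (zeros k S)) * (int Q - 1) ^ (d - 1)"
proof -
  let ?X = "{..<k} \<rightarrow>\<^sub>E (UNIV::'a set)" and ?Y = "{k..<k + d} \<rightarrow>\<^sub>E (UNIV::'a set)"
  define F where "F = (\<lambda>x::nat \<Rightarrow> 'a. \<Sum>\<alpha>\<in>S. \<Prod>i<k. x i ^ \<alpha> i)"
  define J where "J = (\<lambda>(x, y) i. if i < k then x i else y i :: 'a)"
  have "\<beta> k \<noteq> 0" using assms by simp
  then have "\<beta> \<notin> S" using S by (auto simp: hmonos_def)
  moreover have "finite S" using S finite_hmonos finite_subset by blast
  moreover have "(\<Sum>\<alpha>\<in>S. \<Prod>i<k + d. x i ^ \<alpha> i) = F x" for x
    unfolding F_def
  proof (intro sum.cong refl prod.mono_neutral_right ballI)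
    fix \<alpha> i assume "\<alpha> \<in> S" "i \<in> {..<k + d} - {..<k}"
    then have "\<alpha> i = 0" using S by (auto simp: hmonos_def)
    then show "x i ^ \<alpha> i = 1" by simp
  qed auto
  moreover have "(\<Prod>i<k + d. x i ^ \<beta> i) = (\<Prod>i\<in>{k..<k + d}. x i)" for x :: "nat \<Rightarrow> 'a"
  proof -
    have "(\<Prod>i<k + d. x i ^ \<beta> i) = (\<Prod>i\<in>{k..<k + d}. x i ^ \<beta> i)"
      by (rule prod.mono_neutral_right) (auto simp: \<beta>_def)
    also have "\<dots> = (\<Prod>i\<in>{k..<k + d}. x i)" by (intro prod.cong) (auto simp: \<beta>_def)
    finally show ?thesis .
  qed
  ultimately have zeros: "zeros (k + d) (insert \<beta> S)
      = card {x \<in> {..<k + d} \<rightarrow>\<^sub>E UNIV. (\<Prod>i\<in>{k..<k + d}. x i) = - F x}"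
    by (simp add: zeros_def eq_neg_iff_add_eq_0)
  have F_cong: "F x = F x'" if "\<And>i. i < k \<Longrightarrow> x i = x' i" for x x'
    unfolding F_def using that by (intro sum.cong prod.cong) auto
  have bij: "bij_betw J (Sigma ?X (\<lambda>x. {y \<in> ?Y. (\<Prod>i\<in>{k..<k + d}. y i) = - F x}))
    {x \<in> {..<k + d} \<rightarrow>\<^sub>E UNIV. (\<Prod>i\<in>{k..<k + d}. x i) = - F x}"
  proof (rule bij_betwI[of _ _ _ "\<lambda>x. (restrict x {..<k}, restrict x {k..<k + d})"])
    have FJ: "F (J (x, y)) = F x" "(\<Prod>i\<in>{k..<k + d}. J (x, y) i) = (\<Prod>i\<in>{k..<k + d}. y i)" for x y
      by (auto simp: J_def intro!: F_cong prod.cong)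
    show "J \<in> Sigma ?X (\<lambda>x. {y \<in> ?Y. (\<Prod>i\<in>{k..<k + d}. y i) = - F x}) \<rightarrow>
      {x \<in> {..<k + d} \<rightarrow>\<^sub>E UNIV. (\<Prod>i\<in>{k..<k + d}. x i) = - F x}"
    proof (rule Pi_I)
      fix w assume "w \<in> Sigma ?X (\<lambda>x. {y \<in> ?Y. (\<Prod>i\<in>{k..<k + d}. y i) = - F x})"
      then obtain x y where w: "w = (x, y)" "y \<in> ?Y" "(\<Prod>i\<in>{k..<k + d}. y i) = - F x" by blast
      have "J w \<in> {..<k + d} \<rightarrow>\<^sub>E UNIV"
        using w(2) by (auto simp: w(1) J_def PiE_def extensional_def)
      then show "J w \<in> {x \<in> {..<k + d} \<rightarrow>\<^sub>E UNIV. (\<Prod>i\<in>{k..<k + d}. x i) = - F x}"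
        by (simp only: w(1,3) FJ mem_Collect_eq simp_thms)
    qed
    have F_restrict: "F (restrict x {..<k}) = F x" for x by (rule F_cong) auto
    show "(\<lambda>x. (restrict x {..<k}, restrict x {k..<k + d})) \<in>
      {x \<in> {..<k + d} \<rightarrow>\<^sub>E UNIV. (\<Prod>i\<in>{k..<k + d}. x i) = - F x} \<rightarrow>
      Sigma ?X (\<lambda>x. {y \<in> ?Y. (\<Prod>i\<in>{k..<k + d}. y i) = - F x})"
      by (auto simp: F_restrict)
    show "(restrict (J z) {..<k}, restrict (J z) {k..<k + d}) = z"
      if "z \<in> Sigma ?X (\<lambda>x. {y \<in> ?Y. (\<Prod>i\<in>{k..<k + d}. y i) = - F x})" for z
      using that by (auto simp: J_def fun_eq_iff PiE_def extensional_def)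
    show "J (restrict x {..<k}, restrict x {k..<k + d}) = x"
      if "x \<in> {x \<in> {..<k + d} \<rightarrow>\<^sub>E UNIV. (\<Prod>i\<in>{k..<k + d}. x i) = - F x}" for x
      using that by (auto simp: J_def fun_eq_iff PiE_def extensional_def)
  qed
  have finite_Y: "finite ?Y" by (intro finite_PiE) auto
  have "zeros (k + d) (insert \<beta> S)
      = card (Sigma ?X (\<lambda>x. {y \<in> ?Y. (\<Prod>i\<in>{k..<k + d}. y i) = - F x}))"
    unfolding zeros using bij by (rule bij_betw_same_card[symmetric])
  also have "\<dots> = (\<Sum>x\<in>?X. card {y \<in> ?Y. (\<Prod>i\<in>{k..<k + d}. y i) = - F x})"
    using finite_Y by (intro card_SigmaI finite_points) simp
  finally have "int (zeros (k + d) (insert \<beta> S))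
      = (\<Sum>x\<in>?X. int (card {y \<in> ?Y. (\<Prod>i\<in>{k..<k + d}. y i) = - F x}))" by simp
  also have "\<dots> = (\<Sum>x\<in>?X. if F x = 0 then int Q ^ d - (int Q - 1) ^ d else (int Q - 1) ^ (d - 1))"
  proof (intro sum.cong refl)
    fix x
    show "int (card {y \<in> ?Y. (\<Prod>i\<in>{k..<k + d}. y i) = - F x})
      = (if F x = 0 then int Q ^ d - (int Q - 1) ^ d else (int Q - 1) ^ (d - 1))"
      using card_prod_eq_0[of "{k..<k + d}"] card_prod_eq[of "{k..<k + d}" "- F x"] \<open>d > 0\<close> Q_gt_1
      by (auto simp: of_nat_diff)
  qed
  also have "\<dots> = (\<Sum>x\<in>{x \<in> ?X. F x = 0}. int Q ^ d - (int Q - 1) ^ d)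
      + (\<Sum>x\<in>{x \<in> ?X. F x \<noteq> 0}. (int Q - 1) ^ (d - 1))"
    by (subst sum.If_cases[OF finite_points]) (simp add: Int_def Compl_eq)
  also have "\<dots> = int (zeros k S) * (int Q ^ d - (int Q - 1) ^ d)
    + (int Q ^ k - int (zeros k S)) * (int Q - 1) ^ (d - 1)"
    using card_compl_points[OF finite_points, of k "\<lambda>x. F x = 0"]
    by (simp add: zeros_def F_def card_points)
  finally show ?thesis .
qed

text \<open>Blocks of \<open>d\<close> fresh variables are added until at most \<open>d + 1\<close> variables remain.
  For \<open>d + 1\<close> variables a single monomial in \<open>d\<close> of them is used: \<open>x\<^sub>0\<^sup>d\<close> plus a block
  would have too many zeros, as \<open>x\<^sup>2 + y z\<close> shows.\<close>

lemma ex_sharp_zeros: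
  assumes "d > 0" and "k > 0"
  shows "\<exists>S u. S \<subseteq> hmonos k d \<and> S \<noteq> {} \<and> int (zeros k S) = int Q ^ ((k - 1) div d) * u \<and> \<not> int p dvd u"
  using assms(2)
proof (induction k rule: less_induct)
  case (less k)
  \<comment> \<open>The zero count of a monomial in s variables is Q^(k-s) times a number prime to
    p, so s must make k - s the required exponent.\<close>
  have monomial: ?case if s: "0 < s" "s \<le> k" "s \<le> d" "k - s = (k - 1) div d" for s
  proof -
    obtain \<alpha> where \<alpha>: "\<alpha> \<in> hmonos k d"
      "int (zeros k {\<alpha>}) = int Q ^ ((k - 1) div d) * (int Q ^ s - (int Q - 1) ^ s)"
      using zeros_monomial[OF s(1-3)] s(4) by auto
    have "int p dvd int Q ^ s" using p_dvd_Q s(1) by (simp add: dvd_power_iff dvd_trans[OF _ dvd_power])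
    then have "\<not> int p dvd int Q ^ s - (int Q - 1) ^ s"
      using not_dvd_Q1_power[of s] by (metis diff_diff_eq2 add_diff_cancel_left' dvd_diff)
    then show ?thesis using \<alpha> by (intro exI[of _ "{\<alpha>}"]) auto
  qed
  consider "d = 1" | "k \<le> d" | "k = d + 1" | "d \<ge> 2" "k \<ge> d + 2" using assms(1) by linarith
  then show ?case
  proof cases
    case 1
    then show ?thesis using less.prems by (intro monomial[of 1]) auto
  next
    case 2
    then show ?thesis using less.prems by (intro monomial[of k]) auto
  next
    case 3
    then show ?thesis using assms(1) by (intro monomial[of d]) auto
  next
    case 4
    define k' where "k' = k - d"
    have k: "k = k' + d" and k': "k' \<ge> 2" "k' < k" using 4 by (simp_all add: k'_def)
    define t where "t = (k' - 1) div d"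
    have t: "(k - 1) div d = Suc t"
    proof -
      have "k - 1 = (k' - 1) + d" using k k' by simp
      then show ?thesis using assms(1) by (simp add: t_def)
    qed
    have "t * 2 \<le> t * d" using 4 by simp
    also have "t * d \<le> k' - 1" by (simp add: t_def)
    finally have k'_t: "k' - Suc t > 0" using k' by linarith
    obtain S u where S: "S \<subseteq> hmonos k' d" "S \<noteq> {}" "int (zeros k' S) = int Q ^ t * u" "\<not> int p dvd u"
      using less.IH[of k'] k' by (auto simp: t_def)
    define \<beta> where "\<beta> = (\<lambda>i. if i \<in> {k'..<k' + d} then 1 else 0 :: nat)"
    \<comment> \<open>Since Q - 1 + 1 = Q, the terms with the old zero count combine and gain one
      factor Q. Modulo p only -u (Q - 1)^(d-1) remains of u', because d \<ge> 2 and k' > t +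
      1.\<close>
    define u' where "u' = u * (int Q ^ (d - 1) - (int Q - 1) ^ (d - 1))
        + int Q ^ (k' - Suc t) * (int Q - 1) ^ (d - 1)"
    have "int Q ^ d = int Q * int Q ^ (d - 1)" "(int Q - 1) ^ d = (int Q - 1) * (int Q - 1) ^ (d - 1)"
      using assms(1) by (simp_all flip: power_Suc)
    moreover have "int Q ^ k' = int Q ^ Suc t * int Q ^ (k' - Suc t)"
      unfolding power_add[symmetric] using k'_t by simp
    ultimately have "int (zeros k (insert \<beta> S)) = int Q ^ Suc t * u'"
      unfolding k \<beta>_def zeros_add_block[OF S(1) assms(1)] S(3) u'_def
      by (simp only: power_Suc) (simp add: algebra_simps)
    moreover have "\<not> int p dvd u'"
    proof
      assume "int p dvd u'"
      have dvd: "int p dvd int Q ^ n" if "n > 0" for n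
        using p_dvd_Q that by (simp add: dvd_trans[OF _ dvd_power])
      have "int p dvd u * int Q ^ (d - 1) + int Q ^ (k' - Suc t) * (int Q - 1) ^ (d - 1) - u'"
        using 4 k'_t \<open>int p dvd u'\<close> by (intro dvd_diff dvd_add dvd_mult dvd_mult2 dvd) auto
      then have "int p dvd u * (int Q - 1) ^ (d - 1)" by (simp add: u'_def algebra_simps)
      then show False using S(4) not_dvd_Q1_power prime_p by (simp add: prime_dvd_mult_iff)
    qed
    moreover have "insert \<beta> S \<subseteq> hmonos k d"
    proof -
      have "(\<Sum>i<k. \<beta> i) = (\<Sum>i\<in>{k'..<k' + d}. \<beta> i)"
        by (rule sum.mono_neutral_right) (auto simp: \<beta>_def k)
      also have "\<dots> = (\<Sum>i\<in>{k'..<k' + d}. 1)" by (intro sum.cong) (auto simp: \<beta>_def)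
      finally have "(\<Sum>i<k. \<beta> i) = d" by simp
      then have "\<beta> \<in> hmonos k d" by (auto simp: hmonos_def \<beta>_def k)
      moreover have "\<alpha> \<in> hmonos k d" if "\<alpha> \<in> hmonos k' d" for \<alpha>
      proof -
        have "(\<Sum>i<k. \<alpha> i) = (\<Sum>i<k'. \<alpha> i)"
          by (rule sum.mono_neutral_right) (use that k in \<open>auto simp: hmonos_def\<close>)
        then show ?thesis using that k by (auto simp: hmonos_def)
      qed
      ultimately show ?thesis using S(1) by auto
    qed
    ultimately show ?thesis unfolding t by blast
  qed
qed

end

section \<open>From zeros to Artin-Schreier points, and conclusion\<close>

context relative_trace
begin

lemma card_tr_mult:
  assumes "u \<noteq> 0"
  shows "card {z \<in> UNIV - {0}. tr (z * u) = 0} = q ^ (m - 1) - 1"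
proof -
  have "bij_betw (\<lambda>z. z * u) {z \<in> UNIV - {0}. tr (z * u) = 0} ({w. tr w = 0} - {0})"
    by (rule bij_betwI[of _ _ _ "\<lambda>w. w / u"]) (use assms in auto)
  then have "card {z \<in> UNIV - {0}. tr (z * u) = 0} = card ({w. tr w = 0} - {0})"
    by (rule bij_betw_same_card)
  then show ?thesis by (simp add: card_tr_kernel card_Diff_singleton)
qed

text \<open>For g = 1, z itself may be averaged over. Counting pairs (x, z) by x, a zero of f admits
  all Q - 1 values of z, any other point q^(m-1) - 1.\<close>

lemma N_AS_zeros:
  assumes d: "d > 0" and g: "gcd d ((p ^ (e * m) - 1) div (q - 1)) = 1"
    and Z: "Z = card {x \<in> {..<k} \<rightarrow>\<^sub>E UNIV. peval k d c x = (0::'a)}"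
  shows "(int Q - 1) * int (N_AS q k d c) = int Q * int Z * (int q - 1) + int Q ^ k * (int Q - int q)"
proof -
  let ?X = "{..<k} \<rightarrow>\<^sub>E (UNIV::'a set)" and ?f = "peval k d c"
  have "(Q - 1) * N_tr k d c = (\<Sum>z\<in>UNIV - {0::'a}. N_tr k d c)"
    by (simp add: card_Diff_singleton card_p)
  also have "\<dots> = (\<Sum>z\<in>UNIV - {0::'a}. card {x \<in> ?X. tr (z * ?f x) = 0})"
    using N_tr_scale[OF d _ g[symmetric]] by (intro sum.cong) auto
  also have "\<dots> = (\<Sum>z\<in>UNIV - {0::'a}. \<Sum>x\<in>?X. of_bool (tr (z * ?f x) = 0))"
    using finite_points[of k] by (simp add: Int_def)
  also have "\<dots> = (\<Sum>x\<in>?X. \<Sum>z\<in>UNIV - {0::'a}. of_bool (tr (z * ?f x) = 0))" by (rule sum.swap)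
  also have "\<dots> = (\<Sum>x\<in>?X. card {z \<in> UNIV - {0}. tr (z * ?f x) = 0})"
    by (simp add: Int_def)
  also have "\<dots> = (\<Sum>x\<in>?X. if ?f x = 0 then Q - 1 else q ^ (m - 1) - 1)"
  proof (intro sum.cong refl)
    fix x
    have "{z \<in> UNIV - {0::'a}. True} = UNIV - {0}" by auto
    then show "card {z \<in> UNIV - {0}. tr (z * ?f x) = 0} = (if ?f x = 0 then Q - 1 else q ^ (m - 1) - 1)"
      using card_tr_mult[of "?f x"] by (auto simp: card_Diff_singleton card_p)
  qed
  also have "\<dots> = (\<Sum>x\<in>{x \<in> ?X. ?f x = 0}. Q - 1) + (\<Sum>x\<in>{x \<in> ?X. ?f x \<noteq> 0}. q ^ (m - 1) - 1)"
    by (subst sum.If_cases[OF finite_points]) (simp add: Int_def Compl_eq)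
  finally have "(Q - 1) * N_tr k d c = Z * (Q - 1) + card {x \<in> ?X. ?f x \<noteq> 0} * (q ^ (m - 1) - 1)"
    by (simp add: Z)
  then have "int ((Q - 1) * N_tr k d c) = int (Z * (Q - 1) + card {x \<in> ?X. ?f x \<noteq> 0} * (q ^ (m - 1) - 1))"
    by (rule arg_cong)
  moreover have "int (Q - 1) = int Q - 1" using Q_gt_1 by (simp add: of_nat_diff)
  moreover have "int (q ^ (m - 1) - 1) = int q ^ (m - 1) - 1" by (simp add: of_nat_diff)
  moreover have "int (card {x \<in> ?X. ?f x \<noteq> 0}) = int Q ^ k - int Z"
    using card_compl_points[OF finite_points, of k "\<lambda>x. ?f x = 0"] by (simp add: Z card_points)
  ultimately have *: "(int Q - 1) * int (N_tr k d c)
      = int Z * (int Q - 1) + (int Q ^ k - int Z) * (int q ^ (m - 1) - 1)"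
    by (simp only: of_nat_add of_nat_mult)
  have "int q * int q ^ (m - 1) = int Q"
    using m_pos by (cases m) (simp_all add: power_mult power_add)
  then have q: "int q * (int q ^ (m - 1) - 1) = int Q - int q" by (simp add: right_diff_distrib)
  have "(int Q - 1) * int (N_AS q k d c) = int q * ((int Q - 1) * int (N_tr k d c))"
    by (simp add: N_AS_eq)
  also have "\<dots> = int q * (int Z * (int Q - 1)) + (int Q ^ k - int Z) * (int q * (int q ^ (m - 1) - 1))"
    unfolding * by (simp only: distrib_left mult_ac)
  also have "\<dots> = int Q * int Z * (int q - 1) + int Q ^ k * (int Q - int q)"
    unfolding q by (simp only: algebra_simps)
  finally show ?thesis .
qed

text \<open>The origin is a solution. Positivity is required because \<open>multiplicity\<close> is
  0 at 0, where divisibility gives no bound.\<close>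

lemma N_AS_pos:
  assumes "d > 0"
  shows "N_AS q k d (c :: _ \<Rightarrow> 'a) > 0"
proof -
  have "peval k d c (restrict (\<lambda>i. 0 * (0::'a)) {..<k}) = 0"
    using peval_scale[of k d c 0 "\<lambda>_. 0"] assms by (simp add: zero_power)
  define V where "V = {x \<in> {..<k} \<rightarrow>\<^sub>E (UNIV::'a set). tr (peval k d c x) = 0}"
  have "restrict (\<lambda>i. 0 * (0::'a)) {..<k} \<in> V"
    unfolding V_def using \<open>peval k d c _ = 0\<close> by (simp only: mem_Collect_eq restrict_PiE tr_0) simp
  moreover have "finite V"
    unfolding V_def by (rule finite_subset[OF _ finite_points[of k]]) (rule Collect_restrict)
  ultimately have "card V > 0" by (auto simp: card_gt_0_iff)
  then have "N_tr k d c > 0" by (simp only: N_tr_def V_def)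
  then show ?thesis by (simp add: N_AS_eq)
qed

lemma multiplicity_N_AS_ge:
  assumes d: "d > 0" and g: "g = gcd d ((p ^ (e * m) - 1) div (q - 1))"
  shows "\<lceil>real (e * m) / real g * real_of_int \<lceil>real (g * k) / real d\<rceil>\<rceil>
    \<le> int (multiplicity p (N_AS q k d (c :: _ \<Rightarrow> 'a)))"
proof -
  define C where "C = nat \<lceil>real (g * k) / real d\<rceil>"
  define M where "M = nat \<lceil>real (e * m) / real g * real C\<rceil>"
  have g_pos: "g > 0" using d g by simp
  have "- 1 < real (g * k) / real d" by (rule less_le_trans[of _ 0]) auto
  then have "int C = \<lceil>real (g * k) / real d\<rceil>" by (simp add: C_def)
  then have C: "real_of_int \<lceil>real (g * k) / real d\<rceil> = real C" by (metis of_int_of_nat_eq)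
  \<comment> \<open>The factor q of N supplies e orders. Truncated subtraction is harmless, since M
    \<le> e + (M - e) in any case.\<close>
  have "p ^ (M - e) dvd N_tr k d c"
  proof (rule power_dvd_N_tr[OF d g])
    fix y assume "g * k \<le> d * y"
    then have "real (g * k) \<le> real y * real d" by (metis mult.commute of_nat_le_iff of_nat_mult)
    then have "real (g * k) / real d \<le> real y" using d by (simp add: divide_le_eq)
    then show "C \<le> y" by (simp add: C_def nat_le_iff ceiling_le_iff)
  next
    fix w assume "e * m * C \<le> g * (w + e)"
    then have "real (e * m) * real C \<le> real (w + e) * real g"
      by (metis mult.commute of_nat_le_iff of_nat_mult)
    then have "real (e * m) / real g * real C \<le> real (w + e)" using g_pos by (simp add: divide_le_eq)
    then have "M \<le> w + e" by (simp add: M_def nat_le_iff ceiling_le_iff)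
    then show "M - e \<le> w" by simp
  qed
  then have "p ^ e * p ^ (M - e) dvd N_AS q k d c" by (simp add: N_AS_eq)
  then have "p ^ M dvd N_AS q k d c"
    by (rule dvd_trans[rotated]) (simp add: le_imp_power_dvd flip: power_add)
  moreover have "\<not> is_unit p" using p_ge_2 by simp
  moreover have "N_AS q k d c \<noteq> 0" using N_AS_pos[OF d] by simp
  ultimately have "M \<le> multiplicity p (N_AS q k d c)" by (intro multiplicity_geI) auto
  then have "\<lceil>real (e * m) / real g * real C\<rceil> \<le> int (multiplicity p (N_AS q k d c))"
    by (simp only: M_def nat_le_iff)
  then show ?thesis by (simp only: C)
qed

lemma ex_sharp:
  assumes d: "d > 0" and k: "k > 0" and g: "gcd d ((p ^ (e * m) - 1) div (q - 1)) = 1"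
  shows "\<exists>c::(nat \<Rightarrow> nat) \<Rightarrow> 'a. hom_poly k d c \<and>
    multiplicity p (N_AS q k d c) = e * m * Suc ((k - 1) div d)"
proof -
  define t where "t = (k - 1) div d"
  obtain S u where S: "S \<subseteq> hmonos k d" "S \<noteq> {}" "int (zeros k S) = int Q ^ t * u" "\<not> int p dvd u"
    using ex_sharp_zeros[OF d k] by (auto simp: t_def)
  define c :: "(nat \<Rightarrow> nat) \<Rightarrow> 'a" where "c = (\<lambda>\<alpha>. of_bool (\<alpha> \<in> S))"
  have "peval k d c x = (\<Sum>\<alpha>\<in>S. \<Prod>i<k. x i ^ \<alpha> i)" for x
    unfolding peval_def c_def using S(1) finite_hmonos[of k d]
    by (intro sum.mono_neutral_cong_right) auto
  then have Z: "zeros k S = card {x \<in> {..<k} \<rightarrow>\<^sub>E UNIV. peval k d c x = (0::'a)}"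
    by (simp add: zeros_def)
  have "t * d \<le> k - 1" by (simp add: t_def)
  then have "t \<le> k - 1" using d by (metis Suc_leI dual_order.trans mult_le_mono2 mult_1_right One_nat_def)
  then have "int Q ^ k = int Q ^ Suc t * int Q ^ (k - Suc t)"
    unfolding power_add[symmetric] using k by simp
  \<comment> \<open>Modulo p, w is -u: both q and Q - q are divisible by p, which settles even the
    case of a trivial power of Q.\<close>
  define w where "w = u * (int q - 1) + int Q ^ (k - Suc t) * (int Q - int q)"
  have N: "(int Q - 1) * int (N_AS q k d c) = int Q ^ Suc t * w"
    unfolding N_AS_zeros[OF d g Z] S(3) w_def \<open>int Q ^ k = _\<close> by (simp add: algebra_simps)
  have p_q: "int p dvd int q" using e_pos by (simp add: dvd_power)
  have w: "\<not> int p dvd w"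
  proof
    assume "int p dvd w"
    then have "int p dvd u * int q + int Q ^ (k - Suc t) * (int Q - int q) - w"
      using p_q p_dvd_Q by (intro dvd_diff dvd_add dvd_mult) auto
    then show False using S(4) by (simp add: w_def algebra_simps)
  qed
  have "multiplicity p (N_AS q k d c) = e * m * Suc t"
  proof (rule multiplicity_eqI)
    have "int (p ^ (e * m * Suc t)) dvd (int Q - 1) * int (N_AS q k d c)"
      unfolding N by (simp only: power_mult of_nat_power dvd_triv_left)
    moreover have "coprime (int (p ^ (e * m * Suc t))) (int Q - 1)"
      using not_dvd_Q1_power[of 1] prime_p by (simp add: prime_imp_coprime)
    ultimately have "int (p ^ (e * m * Suc t)) dvd int (N_AS q k d c)"
      by (simp only: coprime_dvd_mult_right_iff)
    then show "p ^ (e * m * Suc t) dvd N_AS q k d c" by (simp only: int_dvd_int_iff)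
    show "\<not> p ^ Suc (e * m * Suc t) dvd N_AS q k d c"
    proof
      assume "p ^ Suc (e * m * Suc t) dvd N_AS q k d c"
      then have "int (p ^ Suc (e * m * Suc t)) dvd (int Q - 1) * int (N_AS q k d c)"
        by (metis dvd_mult int_dvd_int_iff)
      then have "int Q ^ Suc t * int p dvd int Q ^ Suc t * w"
        unfolding N by (simp only: power_mult of_nat_power power_Suc2 of_nat_mult)
      then show False using w by (simp only: dvd_mult_cancel_left) simp
    qed
  qed
  moreover have "hom_poly k d c" using S(1,2) by (auto simp: hom_poly_def c_def)
  ultimately show ?thesis by (auto simp: t_def)
qed

end

text \<open>Links the exponent of the sharp example, obtained by integer division, to the ceiling in
  the theorem.\<close>

lemma ceiling_divide_nat:
  assumes "d > 0" and "k > 0"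
  shows "\<lceil>real k / real d\<rceil> = int (Suc ((k - 1) div d))"
proof (rule ceiling_unique)
  have "(k - 1) div d * d < k" using assms(2) by (metis Suc_pred div_times_less_eq_dividend le_imp_less_Suc One_nat_def)
  then have "real ((k - 1) div d) * real d < real k" by (metis of_nat_less_iff of_nat_mult)
  then show "real_of_int (int (Suc ((k - 1) div d))) - 1 < real k / real d"
    using assms(1) by (simp add: less_divide_eq)
  have "k \<le> Suc ((k - 1) div d) * d"
    using assms dividend_less_div_times[of d "k - 1"] by simp
  then have "real k \<le> real (Suc ((k - 1) div d)) * real d" by (metis of_nat_le_iff of_nat_mult)
  then show "real k / real d \<le> real_of_int (int (Suc ((k - 1) div d)))"
    using assms(1) by (simp add: divide_le_eq del: of_nat_Suc)
qed

theorem theorem5p3: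
  fixes c :: "(nat \<Rightarrow> nat) \<Rightarrow> 'a::{field,finite}"
    and p e m k d :: nat
  assumes "prime p" and "e \<ge> 1" and "m \<ge> 1" and "k \<ge> 1" and "d \<ge> 1"
    and "CARD('a) = (p ^ e) ^ m"
    and "hom_poly k d c"
  shows "int (multiplicity p (N_AS (p ^ e) k d c)) \<ge>
           (let g = gcd d (((p ^ e) ^ m - 1) div (p ^ e - 1)) in
             \<lceil>real (e * m) / real g * real_of_int \<lceil>real (g * k) / real d\<rceil>\<rceil>)
    \<and> (gcd d (((p ^ e) ^ m - 1) div (p ^ e - 1)) = 1 \<longrightarrow>
         int (multiplicity p (N_AS (p ^ e) k d c)) \<ge> int (e * m) * \<lceil>real k / real d\<rceil>
       \<and> (\<exists>c' :: (nat \<Rightarrow> nat) \<Rightarrow> 'a. hom_poly k d c' \<and>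
            int (multiplicity p (N_AS (p ^ e) k d c')) = int (e * m) * \<lceil>real k / real d\<rceil>))"
proof -
  interpret relative_trace p e m "TYPE('a)"
    by unfold_locales (use assms in \<open>simp_all add: power_mult\<close>)
  define g where "g = gcd d (((p ^ e) ^ m - 1) div (p ^ e - 1))"
  have g: "g = gcd d ((p ^ (e * m) - 1) div (p ^ e - 1))" by (simp add: g_def power_mult)
  have d: "d > 0" and k: "k > 0" using assms by simp_all
  have ge: "\<lceil>real (e * m) / real g * real_of_int \<lceil>real (g * k) / real d\<rceil>\<rceil>
      \<le> int (multiplicity p (N_AS (p ^ e) k d c))"
    by (rule multiplicity_N_AS_ge[OF d g])
  moreover have "int (e * m) * \<lceil>real k / real d\<rceil> \<le> int (multiplicity p (N_AS (p ^ e) k d c))"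
    if "g = 1"
  proof -
    have "real (e * m) / real g * real_of_int \<lceil>real (g * k) / real d\<rceil>
        = real_of_int (int (e * m) * \<lceil>real k / real d\<rceil>)" by (simp add: that)
    then show ?thesis using ge by (simp only: ceiling_of_int)
  qed
  moreover have "\<exists>c' :: (nat \<Rightarrow> nat) \<Rightarrow> 'a. hom_poly k d c' \<and>
      int (multiplicity p (N_AS (p ^ e) k d c')) = int (e * m) * \<lceil>real k / real d\<rceil>" if "g = 1"
    using ex_sharp[OF d k] that unfolding g ceiling_divide_nat[OF d k] by (metis of_nat_mult)
  ultimately show ?thesis unfolding Let_def g_def[symmetric] by blast
qed

end
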